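(* The set of all good odd positive integers has positive lower asymptotic density.
   Context: An odd positive integer $m$ is called good if for every integer $a$ the congruence $x^k-x^{k-1}\equiv a \pmod m$ has a solution with $k$ a positive integer and $x$ an integer satisfying $\gcd(x,m)=1$. *)

theory Defs
  imports "HOL-Analysis.Analysis" "HOL-Number_Theory.Number_Theory"
begin

definition good :: "nat \<Rightarrow> bool" where
  "good m \<longleftrightarrow> m > 0 \<and> odd m \<and>
     (\<forall>a::int. \<exists>(k::nat) (x::int). k > 0 \<and> coprime x (int m) \<and>
        [x ^ k - x ^ (k - 1) = a] (mod int m))"

(* The liminf is taken in ereal because real is not a complete lattice. *)
definition lower_density :: "nat set \<Rightarrow> ereal" where
  "lower_density A = liminf (\<lambda>N. ereal (real (card {n \<in> A. 1 \<le> n \<and> n \<le> N}) / real N))"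

end

theory Submission
  imports Defs "HOL-Real_Asymp.Real_Asymp" "HOL-Library.Discrete_Functions"
begin

text \<open>
  Adjoin the primes of a squarefree \<open>m\<close> one at a time, in increasing order. When the largest
  prime \<open>p\<close> is added to \<open>m' = m / p\<close>, the exponent is already prescribed modulo
  \<open>totient m'\<close>. If \<open>p - 1\<close> has a divisor \<open>e\<close> coprime to \<open>totient m'\<close>, the exponent is still
  free modulo \<open>e\<close>, so it suffices to find an \<open>x\<close> of order \<open>e\<close> modulo \<open>p\<close> such that \<open>x - 1\<close> lies
  in the coset \<open>a G\<close> of the group \<open>G\<close> of \<open>e\<close>-th roots of unity. A second moment argument shows that
  the number of \<open>x\<close> in a subgroup \<open>H \<le> G\<close> with \<open>x - 1 \<in> a G\<close> differs from \<open>|H||G| / p\<close> by at most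
  \<open>sqrt p\<close>; sieving out the proper subgroups gives such an \<open>x\<close> as soon as \<open>e\<close> is a little larger
  than \<open>p\<^bsup>3/4\<^esup>\<close> and has no small prime factors.

  Take for \<open>e\<close> the part of \<open>p - 1\<close> composed of primes above \<open>(log p)\<^sup>3\<close>. The argument breaks down only if
  \<open>m\<close> has a divisor of the form \<open>p\<^sup>2\<close>, or \<open>p\<close> where the smooth part of \<open>p - 1\<close> exceeds
  \<open>p\<^bsup>1/8\<^esup>\<close>, or \<open>p q\<close> where \<open>q < p\<close> and \<open>p - 1\<close>, \<open>q - 1\<close> share a divisor above \<open>(log p)\<^sup>3\<close>. The sum of
  the reciprocals of these exceptional divisors converges (for the smooth parts by Rankin's
  method), so a positive proportion of the integers congruent to 1 modulo \<open>2 y!\<close>, for \<open>y\<close> large,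
  have no exceptional divisor.
\<close>

subsection \<open>Differences in subgroups modulo a prime\<close>

text \<open>A nonempty finite set of units closed under multiplication is a group. For prime
  \<open>p\<close> this therefore describes the subgroups of the units modulo \<open>p\<close> by
  their residues, together with the empty set.\<close>

definition mod_closed :: "nat \<Rightarrow> nat set \<Rightarrow> bool" where
  "mod_closed p G \<longleftrightarrow> G \<subseteq> {0<..<p} \<and> (\<forall>x\<in>G. \<forall>y\<in>G. x * y mod p \<in> G)"

text \<open>If \<open>mod_closed p G\<close> holds and the prime \<open>p\<close> does not divide
  \<open>c\<close>, distinct \<open>g\<close> give distinct residues \<open>c * g\<close>. At
  \<open>x = 1\<close> the sum then counts the \<open>h\<close> in \<open>H\<close> with
  \<open>1 - h\<close> in the coset \<open>c G\<close>. Real values allow a mean and a variance to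
  be formed.\<close>

definition affine_reps :: "nat \<Rightarrow> nat set \<Rightarrow> nat set \<Rightarrow> nat \<Rightarrow> nat \<Rightarrow> real" where
  "affine_reps p H G c x = (\<Sum>h\<in>H. \<Sum>g\<in>G. of_bool [h + c * g = x] (mod p))"

lemma mod_closed_finite: "mod_closed p G \<Longrightarrow> finite G"
  unfolding mod_closed_def by (meson finite_greaterThanLessThan finite_subset)

lemma mod_closed_bij_betw_mult:
  assumes "prime p" "mod_closed p G" "g \<in> G"
  shows "bij_betw (\<lambda>x. g * x mod p) G G"
proof -
  have "coprime g p"
    using assms unfolding mod_closed_def
    by (metis coprime_commute greaterThanLessThan_iff nat_dvd_not_less prime_imp_coprime subsetD)
  have "inj_on (\<lambda>x. g * x mod p) G"
  proof (rule inj_onI)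
    fix x y assume xy: "x \<in> G" "y \<in> G" "g * x mod p = g * y mod p"
    then have "[x = y] (mod p)"
      using \<open>coprime g p\<close> by (simp add: cong_def[symmetric] cong_mult_lcancel_nat)
    with xy assms(2) show "x = y"
      unfolding mod_closed_def by (metis cong_less_modulus_unique_nat greaterThanLessThan_iff subsetD)
  qed
  moreover have "(\<lambda>x. g * x mod p) ` G \<subseteq> G"
    using assms unfolding mod_closed_def by auto
  ultimately show ?thesis
    using endo_inj_surj[OF mod_closed_finite[OF assms(2)]] by (simp add: bij_betw_def)
qed

text \<open>Multiplication by \<open>g\<close> permutes \<open>G\<close>, so only the coset of
  \<open>c\<close> matters.\<close>

lemma affine_reps_mult_coeff:
  assumes "prime p" "mod_closed p G" "g \<in> G"
  shows "affine_reps p H G (c * g mod p) x = affine_reps p H G c x"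
proof -
  have "(\<Sum>y\<in>G. of_bool [h + (c * g mod p) * y = x] (mod p)) =
        (\<Sum>y\<in>G. of_bool [h + c * y = x] (mod p) :: real)" for h
  proof -
    have "(\<Sum>y\<in>G. of_bool [h + c * y = x] (mod p) :: real) =
          (\<Sum>y\<in>G. of_bool [h + c * (g * y mod p) = x] (mod p))"
      by (rule sum.reindex_bij_betw[OF mod_closed_bij_betw_mult[OF assms], symmetric])
    moreover have "[h + c * (g * y mod p) = x] (mod p) \<longleftrightarrow> [h + (c * g mod p) * y = x] (mod p)" for y
    proof -
      have "[c * (g * y mod p) = (c * g mod p) * y] (mod p)"
        by (simp add: cong_def mod_simps mult.assoc)
      then show ?thesis by (meson cong_add_lcancel_nat cong_sym cong_trans)
    qed
    ultimately show ?thesis by simp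
  qed
  then show ?thesis by (simp add: affine_reps_def)
qed

text \<open>Multiplying \<open>h + c * g = x\<close> by \<open>h0\<close> permutes both
  \<open>H\<close> and \<open>G\<close>, since \<open>h0\<close> lies in both.\<close>

lemma affine_reps_mult_target:
  assumes "prime p" "mod_closed p G" "mod_closed p H" "H \<subseteq> G" "h0 \<in> H"
  shows "affine_reps p H G c (h0 * x mod p) = affine_reps p H G c x"
proof -
  have "coprime h0 p"
    using assms unfolding mod_closed_def
    by (metis coprime_commute greaterThanLessThan_iff nat_dvd_not_less prime_imp_coprime subsetD)
  have "affine_reps p H G c (h0 * x mod p) =
        (\<Sum>h\<in>H. \<Sum>g\<in>G. of_bool [h0 * h mod p + c * g = h0 * x mod p] (mod p))"
    unfolding affine_reps_def
    by (rule sum.reindex_bij_betw[OF mod_closed_bij_betw_mult[OF assms(1,3,5)], symmetric])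
  also have "\<dots> = (\<Sum>h\<in>H. \<Sum>g\<in>G. of_bool [h0 * h mod p + c * (h0 * g mod p) = h0 * x mod p] (mod p))"
    using assms
    by (intro sum.cong refl
        sum.reindex_bij_betw[OF mod_closed_bij_betw_mult[of p G h0], symmetric]) auto
  also have "\<dots> = affine_reps p H G c x"
    unfolding affine_reps_def
  proof (intro sum.cong refl)
    fix h g
    have "[h0 * h mod p + c * (h0 * g mod p) = h0 * x mod p] (mod p) \<longleftrightarrow>
          [h0 * (h + c * g) = h0 * x] (mod p)"
    proof -
      have "[h0 * h mod p + c * (h0 * g mod p) = h0 * h + c * (h0 * g)] (mod p)"
        by (intro cong_add cong_mult) (auto simp: cong_def)
      also have "h0 * h + c * (h0 * g) = h0 * (h + c * g)" by (simp add: algebra_simps)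
      finally show ?thesis by (simp add: cong_def)
    qed
    also have "\<dots> \<longleftrightarrow> [h + c * g = x] (mod p)"
      using \<open>coprime h0 p\<close> by (rule cong_mult_lcancel_nat)
    finally show "of_bool [h0 * h mod p + c * (h0 * g mod p) = h0 * x mod p] (mod p) =
      (of_bool [h + c * g = x] (mod p) :: real)" by simp
  qed
  finally show ?thesis .
qed

section \<open>Second moment of the representation counts\<close>

lemma sum_of_bool_cong:
  fixes m n p :: nat
  assumes "p > 0"
  shows "(\<Sum>x<p. of_bool [m = x] (mod p) * of_bool [n = x] (mod p)) = (of_bool [m = n] (mod p) :: real)"
proof -
  have "(\<Sum>x<p. of_bool [m = x] (mod p) * of_bool [n = x] (mod p)) =
        (\<Sum>x<p. if x = m mod p then of_bool [m = n] (mod p) else (0::real))"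
    by (intro sum.cong refl) (auto simp: cong_def)
  then show ?thesis using assms by simp
qed

lemma sum_variance_eq:
  fixes f :: "'a \<Rightarrow> real"
  assumes "finite A" "A \<noteq> {}"
  shows "(\<Sum>x\<in>A. (f x - sum f A / card A)\<^sup>2) = (\<Sum>x\<in>A. (f x)\<^sup>2) - (sum f A)\<^sup>2 / card A"
proof -
  have "(\<Sum>x\<in>A. (f x - \<mu>)\<^sup>2) = (\<Sum>x\<in>A. (f x)\<^sup>2) - 2 * \<mu> * sum f A + card A * \<mu>\<^sup>2" for \<mu> :: real
    by (simp add: power2_diff sum.distrib sum_subtractf sum_distrib_left sum_distrib_right mult_ac)
  then have "(\<Sum>x\<in>A. (f x - sum f A / card A)\<^sup>2) =
     (\<Sum>x\<in>A. (f x)\<^sup>2) - 2 * (sum f A / card A) * sum f A + card A * (sum f A / card A)\<^sup>2" .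
  also have "\<dots> = (\<Sum>x\<in>A. (f x)\<^sup>2) - (sum f A)\<^sup>2 / card A"
    using assms by (simp add: field_simps power2_eq_square)
  finally show ?thesis .
qed

lemma sum_affine_reps:
  assumes "p > 0"
  shows "(\<Sum>x<p. affine_reps p H G c x) = card H * card G"
proof -
  have "(\<Sum>x<p. affine_reps p H G c x) =
        (\<Sum>h\<in>H. \<Sum>g\<in>G. \<Sum>x<p. of_bool [h + c * g = x] (mod p))"
    unfolding affine_reps_def
    by (subst sum.swap[of _ H "{..<p}"], subst sum.swap[of _ G "{..<p}"]) simp
  also have "\<dots> = (\<Sum>h\<in>H. \<Sum>g\<in>G. 1)"
    using sum_of_bool_cong[OF assms, of n n for n] by (simp flip: of_bool_conj del: sum_of_bool_eq)
  finally show ?thesis by simp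
qed

lemma sum_affine_reps_squared:
  assumes "p > 0"
  shows "(\<Sum>x<p. (affine_reps p H G c x)\<^sup>2) =
         (\<Sum>u\<in>H \<times> G. \<Sum>v\<in>H \<times> G. of_bool [fst u + c * snd u = fst v + c * snd v] (mod p))"
proof -
  have "affine_reps p H G c x = (\<Sum>u\<in>H \<times> G. of_bool [fst u + c * snd u = x] (mod p))" for x
    unfolding affine_reps_def by (simp add: sum.cartesian_product case_prod_beta)
  then have "(\<Sum>x<p. (affine_reps p H G c x)\<^sup>2) =
     (\<Sum>x<p. \<Sum>u\<in>H \<times> G. \<Sum>v\<in>H \<times> G. of_bool [fst u + c * snd u = x] (mod p) * of_bool [fst v + c * snd v = x] (mod p))"
    by (simp add: power2_eq_square sum_product)
  also have "\<dots> = (\<Sum>u\<in>H \<times> G. \<Sum>v\<in>H \<times> G. \<Sum>x<p. of_bool [fst u + c * snd u = x] (mod p) * of_bool [fst v + c * snd v = x] (mod p))"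
    by (subst sum.swap[of _ "H \<times> G" "{..<p}"], subst sum.swap[of _ "H \<times> G" "{..<p}"]) simp
  finally show ?thesis by (simp only: sum_of_bool_cong[OF assms])
qed

text \<open>The collision condition \<open>c * (g - g') = h' - h\<close> is linear in
  \<open>c\<close>. If \<open>g\<close> and \<open>g'\<close> differ, it has at most one solution;
  if they agree, it forces \<open>h = h'\<close>, and then every \<open>c\<close> is a
  solution.\<close>

lemma card_collisions_le:
  assumes "prime p" "mod_closed p G" "mod_closed p H" "u \<in> H \<times> G" "v \<in> H \<times> G"
  shows "(\<Sum>c\<in>{0<..<p}. of_bool [fst u + c * snd u = fst v + c * snd v] (mod p)) \<le>
         (if u = v then real p - 1 else 0) + (of_bool (snd u \<noteq> snd v) :: real)"
proof -
  have p: "p > 1" using assms(1) prime_gt_1_nat by blast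
  obtain h g h' g' where uv: "u = (h, g)" "v = (h', g')" by fastforce
  have lt: "h < p" "h' < p" "g < p" "g' < p"
    using assms uv unfolding mod_closed_def by auto
  let ?C = "{c \<in> {0<..<p}. [h + c * g = h' + c * g'] (mod p)}"
  have eq: "(\<Sum>c\<in>{0<..<p}. of_bool [fst u + c * snd u = fst v + c * snd v] (mod p)) = real (card ?C)"
    by (simp add: uv of_bool_def sum.If_cases Int_def)
  show ?thesis
  proof (cases "g = g'")
    case True
    have "?C = {}" if "h \<noteq> h'"
      using that lt True by (auto simp: cong_add_rcancel_nat cong_less_modulus_unique_nat)
    moreover have "card ?C \<le> p - 1"
    proof -
      have "card ?C \<le> card {0<..<p}" by (intro card_mono) auto
      then show ?thesis by simp
    qed
    ultimately show ?thesis
      unfolding eq using True p by (auto simp: uv of_nat_diff)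
  next
    case False
    have "c = c'" if c: "c \<in> ?C" "c' \<in> ?C" for c c'
    proof -
      have "int p dvd (int h + int c * int g) - (int h' + int c * int g')"
           "int p dvd (int h + int c' * int g) - (int h' + int c' * int g')"
        using c by (auto simp: cong_iff_dvd_diff simp flip: cong_int_iff)
      then have "int p dvd ((int h + int c * int g) - (int h' + int c * int g')) - ((int h + int c' * int g) - (int h' + int c' * int g'))"
        by (rule dvd_diff)
      also have "\<dots> = (int c - int c') * (int g - int g')" by (simp add: algebra_simps)
      finally have "int p dvd int c - int c' \<or> int p dvd int g - int g'"
        using assms(1) by (simp add: prime_dvd_mult_iff)
      then have "[c = c'] (mod p) \<or> [g = g'] (mod p)"
        by (simp add: cong_iff_dvd_diff flip: cong_int_iff)
      with False lt c show ?thesis using cong_less_modulus_unique_nat by auto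
    qed
    then have "card ?C \<le> 1" by (simp add: card_le_Suc0_iff_eq)
    with False show ?thesis unfolding eq by (simp add: uv)
  qed
qed

text \<open>Averaged over all \<open>c \<noteq> 0\<close>, the representation counts have the variance of independent
  events; since the count is constant along cosets, this average bound holds pointwise.\<close>

lemma affine_reps_deviation:
  assumes "prime p" "mod_closed p G" "mod_closed p H" "H \<subseteq> G" "H \<noteq> {}" "\<not> p dvd a"
  shows "\<bar>affine_reps p H G a 1 - card H * card G / p\<bar> \<le> sqrt p"
proof -
  have p: "p > 1" using assms(1) prime_gt_1_nat by blast
  have fin: "finite G" "finite H" using assms mod_closed_finite by blast+
  define V where "V c = (\<Sum>x<p. (affine_reps p H G c x - card H * card G / p)\<^sup>2)" for c
  define M where "M = real (card H) * card G"
  have GH: "card G > 0" "card H > 0" using fin assms by (auto simp: card_gt_0_iff)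
  have Gp: "card G < p"
    using card_mono[of "{0<..<p}" G] assms(2) p by (simp add: mod_closed_def)
  have V_eq: "V c = (\<Sum>x<p. (affine_reps p H G c x)\<^sup>2) - M\<^sup>2 / p" for c
    using sum_variance_eq[of "{..<p}" "affine_reps p H G c"] p
    by (simp add: V_def sum_affine_reps M_def lessThan_empty_iff)
  have "(\<Sum>c\<in>{0<..<p}. \<Sum>x<p. (affine_reps p H G c x)\<^sup>2) =
     (\<Sum>u\<in>H \<times> G. \<Sum>v\<in>H \<times> G. \<Sum>c\<in>{0<..<p}. of_bool [fst u + c * snd u = fst v + c * snd v] (mod p))"
    using p
    by (simp add: sum_affine_reps_squared, subst sum.swap[of _ "H \<times> G" "{0<..<p}"],
        subst sum.swap[of _ "H \<times> G" "{0<..<p}"]) simp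
  also have "\<dots> \<le> (\<Sum>u\<in>H \<times> G. \<Sum>v\<in>H \<times> G. (if u = v then real p - 1 else 0) + of_bool (snd u \<noteq> snd v))"
    using assms by (intro sum_mono card_collisions_le) auto
  also have "\<dots> = M * (real p - 1) + (\<Sum>u\<in>H \<times> G. \<Sum>v\<in>H \<times> G. of_bool (snd u \<noteq> snd v))"
    using fin by (simp add: sum.distrib M_def card_cartesian_product)
  also have "(\<Sum>u\<in>H \<times> G. \<Sum>v\<in>H \<times> G. of_bool (snd u \<noteq> snd v) :: real) = M * (card H * (card G - 1))"
  proof -
    have "(\<Sum>v\<in>H \<times> G. of_bool (snd u \<noteq> snd v) :: real) = card H * (card G - 1)" if "u \<in> H \<times> G" for u
    proof -
      have "(\<Sum>v\<in>H \<times> G. of_bool (snd u \<noteq> snd v) :: real) = card {v \<in> H \<times> G. snd u \<noteq> snd v}"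
        using fin by (simp add: of_bool_def sum.If_cases Int_def)
      also have "{v \<in> H \<times> G. snd u \<noteq> snd v} = H \<times> (G - {snd u})" by auto
      finally show ?thesis using that fin by (auto simp: card_cartesian_product)
    qed
    then show ?thesis using fin by (simp add: card_cartesian_product M_def)
  qed
  finally have "(\<Sum>c\<in>{0<..<p}. V c) \<le> M * (real p - 1) + M * (card H * (card G - 1)) - (real p - 1) * (M\<^sup>2 / p)"
    using p by (simp add: V_eq sum_subtractf of_nat_diff)
  \<comment> \<open>As \<open>M = card H * card G\<close>, the collisions with distinct second
    components cancel the squared mean, leaving only
    \<open>M\<^sup>2 / p - M * card H\<close>.\<close>
  also have "\<dots> = M * (real p - 1 - card H + M / p)"
    using p GH by (simp add: M_def field_simps power2_eq_square of_nat_diff)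
  also have "\<dots> \<le> M * p"
  proof (rule mult_left_mono)
    have "M / p \<le> card H" using Gp p by (simp add: M_def field_simps mult_right_mono)
    then show "real p - 1 - card H + M / p \<le> p" by simp
  qed (simp add: M_def)
  finally have sumV: "(\<Sum>c\<in>{0<..<p}. V c) \<le> M * p" .

  have inj: "inj_on (\<lambda>g. a * g mod p) G"
  proof (rule inj_onI)
    fix x y assume xy: "x \<in> G" "y \<in> G" "a * x mod p = a * y mod p"
    have "coprime a p" using prime_imp_coprime[OF assms(1,6)] by (simp add: coprime_commute)
    with xy have "[x = y] (mod p)" by (simp add: cong_def[symmetric] cong_mult_lcancel_nat)
    with xy assms(2) show "x = y"
      unfolding mod_closed_def by (metis cong_less_modulus_unique_nat greaterThanLessThan_iff subsetD)
  qed
  have sub: "(\<lambda>g. a * g mod p) ` G \<subseteq> {0<..<p}"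
  proof
    fix y assume "y \<in> (\<lambda>g. a * g mod p) ` G"
    then obtain g where g: "g \<in> G" "y = a * g mod p" by blast
    then have "\<not> p dvd g" using assms(2) unfolding mod_closed_def
      by (metis greaterThanLessThan_iff nat_dvd_not_less subsetD)
    with g assms show "y \<in> {0<..<p}"
      using p by (auto simp: prime_dvd_mult_iff mod_greater_zero_iff_not_dvd)
  qed
  \<comment> \<open>\<open>V\<close> is constant on the coset \<open>a G\<close>, whose
    \<open>card G\<close> distinct residues all occur in the total; dividing by
    \<open>card G\<close> bounds the single value \<open>V a\<close>.\<close>
  have "card G * V a = (\<Sum>g\<in>G. V (a * g mod p))"
    using assms by (simp add: V_def affine_reps_mult_coeff)
  also have "\<dots> = (\<Sum>c\<in>(\<lambda>g. a * g mod p) ` G. V c)"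
    using inj by (simp add: sum.reindex)
  also have "\<dots> \<le> (\<Sum>c\<in>{0<..<p}. V c)"
    using sub by (intro sum_mono2) (auto simp: V_def intro: sum_nonneg)
  finally have "card G * V a \<le> card G * (card H * p)" using sumV by (simp add: M_def mult_ac)
  then have Va: "V a \<le> card H * p" using GH by simp

  \<comment> \<open>The count takes the same value at every \<open>h = h * 1\<close> in
    \<open>H\<close>, so the deviation at 1 occurs \<open>card H\<close> times in
    \<open>V a\<close>.\<close>
  have "card H * (affine_reps p H G a 1 - card H * card G / p)\<^sup>2 =
        (\<Sum>h\<in>H. (affine_reps p H G a h - card H * card G / p)\<^sup>2)"
  proof -
    have "affine_reps p H G a h = affine_reps p H G a 1" if "h \<in> H" for h
    proof -
      have "h < p" using that assms(3) by (auto simp: mod_closed_def)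
      then show ?thesis using affine_reps_mult_target[OF assms(1-4) that, of a 1] by simp
    qed
    then show ?thesis by simp
  qed
  also have "\<dots> \<le> V a"
    unfolding V_def using assms(3) by (intro sum_mono2) (auto simp: mod_closed_def)
  finally have "card H * (affine_reps p H G a 1 - card H * card G / p)\<^sup>2 \<le> card H * real p"
    using Va by simp
  then have "(affine_reps p H G a 1 - card H * card G / p)\<^sup>2 \<le> p"
    using GH by simp
  then show ?thesis by (simp add: real_le_rsqrt)
qed

section \<open>Roots of unity modulo a prime\<close>

definition unity_roots :: "nat \<Rightarrow> nat \<Rightarrow> nat set" where
  "unity_roots p e = {x \<in> totatives p. ord p x dvd e}"

lemma mod_closed_unity_roots:
  assumes "prime p"
  shows "mod_closed p (unity_roots p e)"
  unfolding mod_closed_def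
proof (intro conjI ballI)
  have p: "p > 1" using assms prime_gt_1_nat by blast
  show "unity_roots p e \<subseteq> {0<..<p}"
    using p by (auto simp: unity_roots_def totatives_less in_totatives_iff)
  fix x y assume xy: "x \<in> unity_roots p e" "y \<in> unity_roots p e"
  then have "[x ^ e = 1] (mod p)" "[y ^ e = 1] (mod p)" "coprime x p" "coprime y p"
    by (auto simp: unity_roots_def ord_divides' in_totatives_iff)
  then have "[(x * y) ^ e = 1 * 1] (mod p)" "coprime (x * y) p"
    unfolding power_mult_distrib by (blast intro: cong_mult, simp)
  moreover have "x * y mod p > 0"
  proof (rule Nat.gr0I)
    assume "x * y mod p = 0"
    then have "p dvd x * y" by auto
    with \<open>coprime (x * y) p\<close> have "is_unit p" by (meson coprime_common_divisor dvd_refl)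
    with p show False by simp
  qed
  ultimately show "x * y mod p \<in> unity_roots p e"
    using p by (auto simp: unity_roots_def ord_divides' in_totatives_iff coprime_commute less_imp_le)
qed

text \<open>Defining the set through \<open>ord\<close> splits it by exact order. Each order
  \<open>d\<close> dividing \<open>p - 1\<close> is attained by \<open>totient d\<close> residues,
  and the totients of the divisors of \<open>e\<close> add up to \<open>e\<close>.\<close>

lemma card_unity_roots:
  assumes "prime p" "e dvd p - 1"
  shows "card (unity_roots p e) = e"
proof -
  have p: "p > 1" using assms prime_gt_1_nat by blast
  then have e: "e > 0" using assms(2) by (auto intro!: Nat.gr0I)
  have "unity_roots p e = (\<Union>d\<in>{d. d dvd e}. {x \<in> totatives p. ord p x = d})"
    by (auto simp: unity_roots_def)
  also have "card \<dots> = (\<Sum>d | d dvd e. card {x \<in> totatives p. ord p x = d})"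
    using e by (subst card_UN_disjoint) auto
  also have "\<dots> = (\<Sum>d | d dvd e. totient d)"
    using assms p by (intro sum.cong refl)
      (auto simp: prime_card_elements_with_ord_eq_totient intro: dvd_trans)
  also have "\<dots> = e" by (rule totient_divisor_sum)
  finally show ?thesis .
qed

text \<open>The powers of an element of order \<open>e\<close> are \<open>e\<close> distinct roots
  of unity, and there are only \<open>e\<close> of them.\<close>

lemma unity_root_is_power:
  assumes "prime p" "e dvd p - 1" "x \<in> totatives p" "ord p x = e" "g \<in> unity_roots p e"
  shows "\<exists>i. [x ^ i = g] (mod p)"
proof -
  have p: "p > 1" using assms prime_gt_1_nat by blast
  have cop: "coprime p x" using assms by (simp add: in_totatives_iff coprime_commute)
  have "(\<lambda>k. x ^ k mod p) ` {..<e} = unity_roots p e"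
  proof (rule card_subset_eq)
    show "finite (unity_roots p e)" by (simp add: unity_roots_def)
    show "(\<lambda>k. x ^ k mod p) ` {..<e} \<subseteq> unity_roots p e"
    proof safe
      fix k
      have "ord p (x ^ k) dvd e"
        using cop assms(4) by (simp add: ord_power) (metis dvd_def dvd_div_mult_self gcd_dvd2)
      moreover have "coprime (x ^ k mod p) p"
      proof -
        have "coprime x p" using cop by (simp add: coprime_commute)
        then show ?thesis using p by simp
      qed
      moreover have "x ^ k mod p > 0"
        using \<open>coprime (x ^ k mod p) p\<close> p by (metis coprime_0_left_iff gr0I less_irrefl nat_dvd_1_iff_1)
      ultimately show "x ^ k mod p \<in> unity_roots p e"
        using p by (auto simp: unity_roots_def in_totatives_iff less_imp_le)
    qed
    show "card ((\<lambda>k. x ^ k mod p) ` {..<e}) = card (unity_roots p e)"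
      using inj_power_mod[of p x] cop assms by (simp add: card_image card_unity_roots)
  qed
  with assms(5) obtain k where "g = x ^ k mod p" by blast
  then have "[x ^ k = g] (mod p)" by (simp add: cong_def)
  then show ?thesis ..
qed

lemma dvd_div_prime_if_proper_dvd:
  fixes d e :: nat
  assumes "d dvd e" "d \<noteq> e" "e > 0"
  obtains l where "l \<in> prime_factors e" "d dvd e div l"
proof -
  obtain k where k: "e = d * k" using assms(1) by (auto elim: dvdE)
  with assms have "k \<noteq> 1" by auto
  then obtain l where l: "prime l" "l dvd k" using prime_factor_nat by blast
  then obtain k' where "k = l * k'" by (auto elim: dvdE)
  with k l have "e div l = d * k'" "l dvd e" using prime_gt_0_nat[of l] by auto
  with l assms(3) show ?thesis by (intro that[of l]) (auto simp: in_prime_factors_iff)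
qed

text \<open>If no element of exact order \<open>e\<close> were counted by \<open>f\<close>, each
  counted element would lie in the subgroup of order \<open>e div l\<close> for some prime
  \<open>l\<close> dividing \<open>e\<close>. Comparing the main terms \<open>e\<^sup>2 / p\<close>
  and \<open>e\<^sup>2 / (p * l)\<close>, with an error \<open>sqrt p\<close> for each of the
  \<open>1 + card (prime_factors e)\<close> groups, contradicts \<open>large\<close>.\<close>

lemma exists_generator_affine:
  assumes p: "prime p" and e: "e dvd p - 1" and a: "\<not> p dvd a"
    and large: "(1 + card (prime_factors e)) * sqrt p < (real e)\<^sup>2 / real p * (1 - (\<Sum>l\<in>prime_factors e. 1 / real l))"
  shows "\<exists>x\<in>totatives p. ord p x = e \<and> (\<exists>g\<in>unity_roots p e. [x + a * g = 1] (mod p))"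
proof (rule ccontr)
  assume contra: "\<not> ?thesis"
  have p1: "p > 1" using p prime_gt_1_nat by blast
  have e0: "e > 0" using e p1 by (auto intro!: Nat.gr0I)
  define G where "G d = unity_roots p d" for d
  define f where "f h = (\<Sum>g\<in>G e. of_bool [h + a * g = 1] (mod p) :: real)" for h
  have fin: "finite (G d)" for d by (simp add: G_def unity_roots_def)
  have mono: "G d \<subseteq> G e" if "d dvd e" for d using that by (auto simp: G_def unity_roots_def)
  \<comment> \<open>The deviation bound is applied with \<open>G d\<close> as the smaller and
    \<open>G e\<close> as the larger group; it serves for \<open>d = e\<close> and for
    \<open>d = e div l\<close>.\<close>
  have dev: "\<bar>(\<Sum>h\<in>G d. f h) - real d * e / p\<bar> \<le> sqrt p" if "d dvd e" for d
  proof -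
    have "d dvd p - 1" using that e by (rule dvd_trans)
    moreover from this have "d > 0" using p1 by (auto intro!: Nat.gr0I)
    ultimately have "card (G d) = d" "G d \<noteq> {}"

      unfolding G_def using card_unity_roots[OF p, of d] by fastforce+
    then show ?thesis
      using affine_reps_deviation[of p "G e" "G d" a] p a mono[OF that] e
      by (simp add: G_def mod_closed_unity_roots card_unity_roots affine_reps_def f_def)
  qed
  have f0: "f h \<ge> 0" for h by (auto simp: f_def intro: sum_nonneg)
  have "(\<Sum>h\<in>G e. f h) \<le> (\<Sum>h\<in>G e. \<Sum>l\<in>prime_factors e. if h \<in> G (e div l) then f h else 0)"
  proof (rule sum_mono)
    fix h assume h: "h \<in> G e"
    show "f h \<le> (\<Sum>l\<in>prime_factors e. if h \<in> G (e div l) then f h else 0)"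
    proof (cases "ord p h = e")
      case True
      then have "f h = 0" using contra h by (auto simp: f_def G_def unity_roots_def)
      then show ?thesis using f0 by (simp add: sum_nonneg)
    next
      case False
      then obtain l where l: "l \<in> prime_factors e" "ord p h dvd e div l"
        using dvd_div_prime_if_proper_dvd[of "ord p h" e] h e0 by (auto simp: G_def unity_roots_def)
      then have "f h = (if h \<in> G (e div l) then f h else 0)"
        using h by (auto simp: G_def unity_roots_def)
      also have "\<dots> \<le> (\<Sum>l\<in>prime_factors e. if h \<in> G (e div l) then f h else 0)"
        using l f0 by (intro member_le_sum) auto
      finally show ?thesis .
    qed
  qed
  also have "\<dots> = (\<Sum>l\<in>prime_factors e. \<Sum>h\<in>G e. if h \<in> G (e div l) then f h else 0)"
    by (rule sum.swap)
  also have "\<dots> = (\<Sum>l\<in>prime_factors e. \<Sum>h\<in>G (e div l). f h)"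
  proof (rule sum.cong[OF refl])
    fix l assume "l \<in> prime_factors e"
    then have "G (e div l) \<subseteq> G e" by (intro mono) (auto simp: in_prime_factors_iff div_dvd_iff_mult)
    then show "(\<Sum>h\<in>G e. if h \<in> G (e div l) then f h else 0) = (\<Sum>h\<in>G (e div l). f h)"
      using fin by (simp add: sum.inter_restrict[symmetric] Int_absorb1)
  qed
  also have "\<dots> \<le> (\<Sum>l\<in>prime_factors e. (real e)\<^sup>2 / real p * (1 / real l) + sqrt p)"
  proof (rule sum_mono)
    fix l assume l: "l \<in> prime_factors e"
    then have "real (e div l) = e / l" by (auto simp: in_prime_factors_iff real_of_nat_div)
    with dev[of "e div l"] l show "(\<Sum>h\<in>G (e div l). f h) \<le> (real e)\<^sup>2 / real p * (1 / real l) + sqrt p"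
      by (auto simp: in_prime_factors_iff div_dvd_iff_mult power2_eq_square mult_ac)
  qed
  also have "\<dots> = (real e)\<^sup>2 / real p * (\<Sum>l\<in>prime_factors e. 1 / real l) + card (prime_factors e) * sqrt p"
    by (simp add: sum.distrib sum_distrib_left)
  finally show False
    using dev[of e] large by (simp add: algebra_simps power2_eq_square abs_le_iff)
qed

text \<open>With \<open>g = x ^ i\<close>, the relation \<open>x - 1 = a * g\<close> says that
  \<open>x\<close> to the power \<open>- i\<close> times \<open>x - 1\<close> is \<open>a\<close>;
  the exponent is made nonnegative by periodicity modulo \<open>e\<close>.\<close>

lemma exists_solution_of_order:
  fixes a :: int
  assumes p: "prime p" and e: "e dvd p - 1" and a: "\<not> int p dvd a"
    and large: "(1 + card (prime_factors e)) * sqrt p < (real e)\<^sup>2 / real p * (1 - (\<Sum>l\<in>prime_factors e. 1 / real l))"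
  shows "\<exists>(x::int) j. coprime x (int p) \<and> [x ^ e = 1] (mod int p) \<and> [x ^ j * (x - 1) = a] (mod int p)"
proof -
  have p1: "p > 1" using p prime_gt_1_nat by blast
  have e0: "e > 0" using e p1 by (auto intro!: Nat.gr0I)
  \<comment> \<open>The generator lemma yields \<open>x + b * g = 1\<close>, so \<open>b\<close> has
    to represent \<open>- a\<close>.\<close>
  define b where "b = nat ((- a) mod int p)"
  have b: "[int b = - a] (mod int p)" using p1 by (simp add: b_def cong_def)
  then have "\<not> p dvd b" using a by (metis cong_dvd_iff dvd_minus_iff int_dvd_int_iff)
  then obtain x g where x: "x \<in> totatives p" "ord p x = e" and g: "g \<in> unity_roots p e" "[x + b * g = 1] (mod p)"
    using exists_generator_affine[OF p e _ large] by blast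
  obtain i where i: "[x ^ i = g] (mod p)" using unity_root_is_power[OF p e x g(1)] by blast
  have xe: "[int x ^ e = 1] (mod int p)"
    using x(2) by (metis cong_int_iff of_nat_1 of_nat_power ord)
  have "[int x + int b * int g = 1] (mod int p)"
    using g(2) by (metis cong_int_iff of_nat_1 of_nat_add of_nat_mult)
  moreover have "[int x + int b * int g = int x + - a * int x ^ i] (mod int p)"
    using b i by (intro cong_add cong_mult cong_refl) (simp_all add: cong_sym cong_int_iff flip: of_nat_power)
  ultimately have "[int x - a * int x ^ i = 1] (mod int p)"
    by (metis cong_sym cong_trans diff_conv_add_uminus mult_minus_left)
  then have x1: "[int x - 1 = a * int x ^ i] (mod int p)"
    by (simp add: cong_iff_dvd_diff algebra_simps)
  \<comment> \<open>The exponent \<open>i * (e - 1)\<close> is congruent to \<open>- i\<close>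
    modulo \<open>e\<close>.\<close>
  have "[int x ^ (i * (e - 1)) * (int x - 1) = int x ^ (i * (e - 1)) * (a * int x ^ i)] (mod int p)"
    using x1 by (intro cong_mult cong_refl)
  also have "int x ^ (i * (e - 1)) * (a * int x ^ i) = a * (int x ^ e) ^ i"
    using e0 by (cases e) (simp_all add: power_add power_mult power_mult_distrib mult.commute[of i])
  also have "[a * (int x ^ e) ^ i = a * 1 ^ i] (mod int p)"
    using xe by (intro cong_mult cong_refl cong_pow)
  finally show ?thesis
    using xe x(1) by (intro exI[of _ "int x"] exI[of _ "i * (e - 1)"]) (auto simp: in_totatives_iff)
qed

subsection \<open>Adjoining a prime\<close>

lemma cong_pow_exponent:
  fixes x m :: int
  assumes "[x ^ n = 1] (mod m)" "[s = t] (mod n)"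
  shows "[x ^ s = x ^ t] (mod m)"
proof -
  have *: "[x ^ s = x ^ (s mod n)] (mod m)" for s
  proof -
    have "x ^ s = (x ^ n) ^ (s div n) * x ^ (s mod n)"
      by (simp flip: power_mult power_add)
    also have "[\<dots> = 1 ^ (s div n) * x ^ (s mod n)] (mod m)"
      using assms(1) by (intro cong_mult cong_pow cong_refl)
    finally show ?thesis by simp
  qed
  from *[of s] *[of t] assms(2) show ?thesis
    by (metis cong_def)
qed

lemma euler_theorem_int:
  fixes x :: int
  assumes "coprime x (int m)" "m > 0"
  shows "[x ^ totient m = 1] (mod int m)"
proof -
  define y where "y = nat (x mod int m)"
  have y: "[int y = x] (mod int m)" using assms(2) by (simp add: y_def cong_def)
  then have "coprime y m" using assms(1) by (metis cong_imp_coprime cong_sym coprime_int_iff)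
  then have "[int y ^ totient m = 1] (mod int m)"
    using euler_theorem[of y m] by (metis cong_int_iff of_nat_1 of_nat_power)
  with y show ?thesis by (meson cong_pow cong_sym cong_trans)
qed

text \<open>Since \<open>x ^ k - x ^ (k - 1) = x ^ (k - 1) * (x - 1)\<close>, the solution modulo
  \<open>p\<close> constrains \<open>k - 1\<close> only modulo \<open>e\<close>, and the one modulo
  \<open>m\<close> only modulo \<open>totient m\<close>. These moduli are coprime, so Chinese
  remaindering supplies a common exponent; a second application supplies a common base.\<close>

lemma good_mult_prime:
  assumes p: "prime p" "odd p" "\<not> p dvd m" and m: "good m" and e: "coprime e (totient m)"
    and sol: "\<And>a::int. \<not> int p dvd a \<Longrightarrow>
      \<exists>(x::int) j. coprime x (int p) \<and> [x ^ e = 1] (mod int p) \<and> [x ^ j * (x - 1) = a] (mod int p)"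
  shows "good (p * m)"
  unfolding good_def
proof (intro conjI allI)
  have m0: "m > 0" "odd m" using m by (auto simp: good_def)
  show "p * m > 0" "odd (p * m)" using p m0 prime_gt_0_nat by auto
  fix a :: int
  obtain k0 x0 where k0: "k0 > 0" and x0: "coprime x0 (int m)" "[x0 ^ k0 - x0 ^ (k0 - 1) = a] (mod int m)"
    using m unfolding good_def by blast
  have "\<exists>(x::int) j. coprime x (int p) \<and> [x ^ e = 1] (mod int p) \<and> [x ^ j * (x - 1) = a] (mod int p)"
  proof (cases "int p dvd a")
    case True
    \<comment> \<open>The base 1 makes the left-hand side zero.\<close>
    then show ?thesis by (intro exI[of _ 1]) (auto simp: cong_def)
  qed (rule sol)
  then obtain x1 j where x1: "coprime x1 (int p)" "[x1 ^ e = 1] (mod int p)" "[x1 ^ j * (x1 - 1) = a] (mod int p)"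
    by blast
  obtain t where t: "[t = j] (mod e)" "[t = k0 - 1] (mod totient m)"
    using binary_chinese_remainder_nat[OF e] by blast
  have "coprime p m" using prime_imp_coprime p by blast
  then have pm: "coprime (int p) (int m)" by simp
  obtain x where x: "[x = x1] (mod int p)" "[x = x0] (mod int m)"
    using binary_chinese_remainder_int[OF pm] by blast
  have "[x ^ t * (x - 1) = x1 ^ t * (x1 - 1)] (mod int p)"
    using x by (intro cong_mult cong_pow cong_diff cong_refl)
  also have "[x1 ^ t * (x1 - 1) = x1 ^ j * (x1 - 1)] (mod int p)"
    using cong_pow_exponent[OF x1(2) t(1)] by (intro cong_mult cong_refl)
  also note x1(3)
  finally have "[x ^ t * (x - 1) = a] (mod int p)" .
  moreover have "[x ^ t * (x - 1) = a] (mod int m)"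
  proof -
    have "[x ^ t * (x - 1) = x0 ^ t * (x0 - 1)] (mod int m)"
      using x by (intro cong_mult cong_pow cong_diff cong_refl)
    also have "[x0 ^ t * (x0 - 1) = x0 ^ (k0 - 1) * (x0 - 1)] (mod int m)"
      using cong_pow_exponent[OF euler_theorem_int[OF x0(1) m0(1)] t(2)] by (intro cong_mult cong_refl)
    also have "x0 ^ (k0 - 1) * (x0 - 1) = x0 ^ k0 - x0 ^ (k0 - 1)"
      using k0 by (cases k0) (simp_all add: algebra_simps)
    also note x0(2)
    finally show ?thesis .
  qed
  ultimately have "[x ^ t * (x - 1) = a] (mod int p * int m)"
    using pm by (rule coprime_cong_mult)
  moreover have "x ^ t * (x - 1) = x ^ Suc t - x ^ (Suc t - 1)" by (simp add: algebra_simps)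
  moreover have "coprime x (int (p * m))"
    using x x0 x1 by (metis cong_imp_coprime cong_sym coprime_mult_right_iff of_nat_mult)
  ultimately show "\<exists>k x. k > 0 \<and> coprime x (int (p * m)) \<and> [x ^ k - x ^ (k - 1) = a] (mod int (p * m))"
    by (intro exI[of _ "Suc t"] exI[of _ x]) simp
qed

lemma good_1: "good 1"
  unfolding good_def by (auto intro!: exI[of _ "1::nat"])

subsection \<open>Reciprocal sums\<close>

text \<open>Dyadic blocks are used because \<open>floor_log\<close>, and with it
  \<open>smooth_threshold\<close>, is constant on each of them.\<close>

lemma summable_if_dyadic_block_bound:
  fixes f :: "nat \<Rightarrow> real"
  assumes nonneg: "\<And>n. f n \<ge> 0"
    and block: "\<And>j. (\<Sum>n\<in>{2 ^ j..<2 ^ Suc j}. f n) \<le> B j" and "summable B"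
  shows "summable f"
proof (rule summableI_nonneg_bounded[OF nonneg])
  fix N
  have B0: "B j \<ge> 0" for j
    using block[of j] sum_nonneg[of "{2 ^ j..<2 ^ Suc j}" f] nonneg by (meson order_trans)
  have pow: "(\<Sum>n<2 ^ J. f n) \<le> f 0 + (\<Sum>j<J. B j)" for J
  proof (induction J)
    case (Suc J)
    have "{..<2 ^ Suc J} = {..<2 ^ J} \<union> {2 ^ J..<2 ^ Suc J :: nat}"
      by auto
    moreover have "sum f ({..<2 ^ J} \<union> {2 ^ J..<2 ^ Suc J}) = (\<Sum>n<2 ^ J. f n) + (\<Sum>n\<in>{2 ^ J..<2 ^ Suc J}. f n)"
      by (rule sum.union_disjoint) auto
    ultimately have "(\<Sum>n<2 ^ Suc J. f n) = (\<Sum>n<2 ^ J. f n) + (\<Sum>n\<in>{2 ^ J..<2 ^ Suc J}. f n)"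
      by (simp only:)
    then show ?case using Suc block[of J] unfolding sum.lessThan_Suc by linarith
  qed simp
  have "(\<Sum>n<N. f n) \<le> (\<Sum>n<2 ^ N. f n)"
    using nonneg less_exp[of N] by (intro sum_mono2) auto
  also have "\<dots> \<le> f 0 + (\<Sum>j<N. B j)" by (rule pow)
  also have "(\<Sum>j<N. B j) \<le> suminf B"
    using \<open>summable B\<close> B0 by (intro sum_le_suminf) auto
  finally show "(\<Sum>n<N. f n) \<le> f 0 + suminf B" by simp
qed

section \<open>Reciprocal sums over arithmetic progressions\<close>

lemma inj_on_div_progression:
  "inj_on (\<lambda>n. (n - 1) div d) {n :: nat. n \<ge> 2 \<and> d dvd n - 1}"
proof (rule inj_onI)
  fix m n assume mn: "m \<in> {n. n \<ge> 2 \<and> d dvd n - 1}" "n \<in> {n. n \<ge> 2 \<and> d dvd n - 1}"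
    and eq: "(m - 1) div d = (n - 1) div d"
  have "m - 1 = d * ((m - 1) div d)" "n - 1 = d * ((n - 1) div d)" using mn by auto
  with eq have "m - 1 = n - 1" by metis
  with mn show "m = n" by auto
qed

text \<open>Writing \<open>n = d * t + 1\<close> gives \<open>1 / n \<le> 1 / (d * t)\<close> with
  distinct \<open>t\<close> in \<open>{1..N}\<close>; starting at \<open>n = 2\<close> keeps
  \<open>t\<close> positive.\<close>

lemma sum_inverse_progression_le:
  fixes d :: nat
  assumes "d > 0"
  shows "(\<Sum>n | n \<in> {2..<N} \<and> d dvd n - 1. 1 / real n) \<le> harm N / d"
proof -
  let ?A = "{n. n \<in> {2..<N} \<and> d dvd n - 1}" and ?t = "\<lambda>n. (n - 1) div d"
  have "(\<Sum>n\<in>?A. 1 / real n) \<le> (\<Sum>n\<in>?A. 1 / (d * real (?t n)))"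
  proof (rule sum_mono)
    fix n assume n: "n \<in> ?A"
    then have "d * ?t n = n - 1" by simp
    then have "real d * real (?t n) = real n - 1" using n by (simp flip: of_nat_mult)
    then show "1 / real n \<le> 1 / (real d * real (?t n))" using n by (simp add: frac_le)
  qed
  also have "\<dots> = (\<Sum>t\<in>?t ` ?A. 1 / (d * real t))"
    by (subst sum.reindex) (rule inj_on_subset[OF inj_on_div_progression], auto)
  also have "\<dots> \<le> (\<Sum>t\<in>{1..N}. 1 / (d * real t))"
  proof (intro sum_mono2)
    show "?t ` ?A \<subseteq> {1..N}"
    proof
      fix t assume "t \<in> ?t ` ?A"
      then obtain n where n: "n \<in> ?A" "t = ?t n" by blast
      then have "d \<le> n - 1" by (intro dvd_imp_le) auto
      then have "t \<ge> 1" using n assms by (simp add: div_greater_zero_iff Suc_le_eq)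
      moreover have "n - 1 \<le> N" using n(1) by auto
      then have "t \<le> N" unfolding n(2) by (rule order_trans[OF div_le_dividend])
      ultimately show "t \<in> {1..N}" by simp
    qed
  qed auto
  also have "\<dots> = harm N / d"
    by (simp add: harm_def sum_divide_distrib field_simps)
  finally show ?thesis .
qed

text \<open>One block contains at most \<open>2 ^ Suc j / d\<close> terms of the progression, each
  with reciprocal at most \<open>1 / 2 ^ j\<close>, so no logarithm appears. The condition
  \<open>j > 0\<close> keeps out \<open>n = 1\<close>, where every \<open>d\<close> divides
  \<open>n - 1\<close>.\<close>

lemma sum_inverse_progression_block_le:
  fixes d :: nat
  assumes "d > 0" "j > 0"
  shows "(\<Sum>n | n \<in> {2 ^ j..<2 ^ Suc j} \<and> d dvd n - 1. 1 / real n) \<le> 2 / d"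
proof -
  let ?A = "{n::nat. n \<in> {2 ^ j..<2 ^ Suc j} \<and> d dvd n - 1}" and ?t = "\<lambda>n::nat. (n - 1) div d"
  have j2: "2 \<le> (2::nat) ^ j" using assms(2) self_le_power[of 2 j] by simp
  have "card ?A = card (?t ` ?A)"
    using j2 by (subst card_image) (rule inj_on_subset[OF inj_on_div_progression], auto)
  also have "\<dots> \<le> card {1..2 ^ Suc j div d}"
  proof (intro card_mono)
    show "?t ` ?A \<subseteq> {1..2 ^ Suc j div d}"
    proof
      fix t assume "t \<in> ?t ` ?A"
      then obtain n where n: "n \<in> ?A" "t = ?t n" by blast
      then have "d \<le> n - 1" using j2 by (intro dvd_imp_le) auto
      then have "t \<ge> 1" using n assms by (simp add: div_greater_zero_iff Suc_le_eq)
      moreover have "t \<le> 2 ^ Suc j div d" using n by (auto intro!: div_le_mono)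
      ultimately show "t \<in> {1..2 ^ Suc j div d}" by simp
    qed
  qed auto
  finally have "card ?A \<le> 2 ^ Suc j div d" by simp
  then have "real (card ?A) \<le> real (2 ^ Suc j div d)" by (rule of_nat_mono)
  also have "\<dots> \<le> real (2 ^ Suc j) / d" by (rule of_nat_div_le_of_nat)
  finally have card: "real (card ?A) \<le> 2 * 2 ^ j / d" by simp
  have "(\<Sum>n\<in>?A. 1 / real n) \<le> (\<Sum>n\<in>?A. 1 / 2 ^ j)"
  proof (rule sum_mono)
    fix n assume "n \<in> ?A"
    then have "real (2 ^ j) \<le> real n" by (intro of_nat_mono) auto
    then show "1 / real n \<le> 1 / 2 ^ j" by (intro frac_le) auto
  qed
  also have "\<dots> = real (card ?A) * (1 / 2 ^ j)" by simp
  also have "\<dots> \<le> (2 * 2 ^ j / d) * (1 / 2 ^ j)" using card by (rule mult_right_mono) simp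
  finally show ?thesis by simp
qed

lemma harm_pow2_le: "(harm (2 ^ j) :: real) \<le> j + 1"
proof -
  have "(harm (2 ^ j) :: real) \<le> ln (2 ^ j) + 1"
    using euler_mascheroni_sequence_decreasing[of 1 "2 ^ j"] by (simp add: harm_def)
  also have "ln (2 ^ j :: real) = j * ln 2" by (simp add: ln_realpow)
  also have "\<dots> \<le> real j * 1" using ln_2_less_1 by (intro mult_left_mono) auto
  finally show ?thesis by simp
qed

text \<open>Telescoping, with \<open>1 / (N + 1)\<^sup>2 \<le> 1 / N - 1 / (N + 1)\<close>.\<close>

lemma sum_inverse_squares_tail_le:
  assumes "z > 0"
  shows "(\<Sum>l\<in>{z<..N}. 1 / (real l)\<^sup>2) \<le> 1 / z"
proof -
  have "(\<Sum>l\<in>{z<..N}. 1 / (real l)\<^sup>2) \<le> 1 / z - 1 / N" if "z \<le> N"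
    using that
  proof (induction N rule: dec_induct)
    case (step N)
    have "{z<..Suc N} = insert (Suc N) {z<..N}" using step by auto
    then have "(\<Sum>l\<in>{z<..Suc N}. 1 / (real l)\<^sup>2) = 1 / (real (Suc N))\<^sup>2 + (\<Sum>l\<in>{z<..N}. 1 / (real l)\<^sup>2)"
      by simp
    moreover have "1 / (real (Suc N))\<^sup>2 \<le> 1 / N - 1 / Suc N"
    proof -
      have "1 / (real (Suc N))\<^sup>2 \<le> 1 / (real N * real (Suc N))"
        using step assms by (intro divide_left_mono) (auto simp: power2_eq_square mult_right_mono)
      also have "\<dots> = 1 / N - 1 / Suc N" using step assms by (simp add: field_simps)
      finally show ?thesis .
    qed
    ultimately show ?case using step by simp
  qed simp
  moreover have "1 / real z - 1 / real N \<le> 1 / z" by simp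
  ultimately show ?thesis by (cases "z \<le> N") (linarith, simp)
qed

section \<open>Smooth numbers and Rankin's method\<close>

lemma sum_powr_smooth_le:
  fixes s :: real
  assumes "finite P" "\<And>l. l \<in> P \<Longrightarrow> prime l" "s > 0"
  shows "(\<Sum>d | d \<in> {1..N} \<and> prime_factors d \<subseteq> P. real d powr - s) \<le> (\<Prod>l\<in>P. 1 / (1 - real l powr - s))"
  using assms(1,2)
proof (induction P rule: finite_induct)
  case empty
  have "{d. d \<in> {1..N} \<and> prime_factors d \<subseteq> {}} \<subseteq> {1::nat}"
    by (auto simp: prime_factorization_empty_iff)
  then have "(\<Sum>d | d \<in> {1..N} \<and> prime_factors d \<subseteq> {}. real d powr - s) \<le> (\<Sum>d\<in>{1::nat}. real d powr - s)"
    by (intro sum_mono2) auto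
  then show ?case by simp
next
  case (insert l P)
  define A where "A Q = {d. d \<in> {1..N} \<and> prime_factors d \<subseteq> Q}" for Q
  define x where "x = real l powr - s"
  have l: "prime l" using insert by simp
  then have l1: "l > 1" by (rule prime_gt_1_nat)
  have x: "0 \<le> x" "x < 1" using l1 assms(3) by (auto simp: x_def powr_less_one)
  have fin: "finite (A Q)" for Q by (simp add: A_def)
  \<comment> \<open>Splitting the power of \<open>l\<close> off \<open>d\<close> produces one factor
    of the Euler product. The exponent \<open>i\<close> stays below \<open>N\<close> because
    \<open>i < l ^ i\<close> and \<open>l ^ i \<le> d \<le> N\<close>.\<close>
  have sub: "A (insert l P) \<subseteq> (\<lambda>(i, d). l ^ i * d) ` ({..<N} \<times> A P)"
  proof
    fix d assume d: "d \<in> A (insert l P)"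
    then have d0: "d > 0" by (auto simp: A_def)
    obtain c where c: "d = l ^ multiplicity l d * c" "\<not> l dvd c"
      using multiplicity_decompose'[of d l] d0 l by (metis neq0_conv not_prime_unit)
    have "prime_factors c \<subseteq> P"
    proof
      fix q assume q: "q \<in> prime_factors c"
      then have "q dvd d" using c(1) by (metis dvd_mult in_prime_factors_iff)
      then have "q \<in> prime_factors d" using q d0 by (auto simp: in_prime_factors_iff)
      moreover have "q \<noteq> l" using q c(2) by (auto simp: in_prime_factors_iff)
      ultimately show "q \<in> P" using d by (auto simp: A_def)
    qed
    moreover have "c > 0" using c d0 by (auto intro!: Nat.gr0I)
    moreover have "c \<le> d" using c(1) d0 by (metis dvd_imp_le dvd_triv_right)
    moreover have "multiplicity l d < N"
    proof -
      have "multiplicity l d < l ^ multiplicity l d" using l1 by (simp add: power_gt_expt)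
      also have "\<dots> \<le> d" using d0 multiplicity_dvd by (intro dvd_imp_le) auto
      finally show ?thesis using d by (auto simp: A_def)
    qed
    ultimately have "(multiplicity l d, c) \<in> {..<N} \<times> A P" using d by (auto simp: A_def)
    then show "d \<in> (\<lambda>(i, d). l ^ i * d) ` ({..<N} \<times> A P)" using c(1) by force
  qed
  have "(\<Sum>d\<in>A (insert l P). real d powr - s) \<le> (\<Sum>d\<in>(\<lambda>(i, d). l ^ i * d) ` ({..<N} \<times> A P). real d powr - s)"
    using sub fin by (intro sum_mono2) auto
  also have "\<dots> \<le> (\<Sum>u\<in>{..<N} \<times> A P. real ((\<lambda>(i, d). l ^ i * d) u) powr - s)"
    using fin by (intro order_trans[OF sum_image_le]) (auto simp: o_def)
  also have "\<dots> = (\<Sum>i<N. \<Sum>d\<in>A P. x ^ i * real d powr - s)"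
  proof -
    have "real (l ^ i * d) powr - s = x ^ i * real d powr - s" for i d
    proof -
      have "x ^ i = real l powr (- s * i)" using l1 by (simp add: x_def powr_power mult.commute)
      also have "\<dots> = (real l powr i) powr - s" by (simp add: powr_powr mult.commute)
      also have "real l powr i = real l ^ i" using l1 by (simp add: powr_realpow)
      finally show ?thesis by (simp add: powr_mult)
    qed
    then show ?thesis by (simp add: sum.cartesian_product case_prod_beta)
  qed
  also have "\<dots> = (\<Sum>i<N. x ^ i) * (\<Sum>d\<in>A P. real d powr - s)"
    by (simp add: sum_product)
  also have "\<dots> \<le> (1 / (1 - x)) * (\<Prod>l\<in>P. 1 / (1 - real l powr - s))"
  proof (rule mult_mono)
    have "(\<Sum>i<N. x ^ i) = (1 - x ^ N) / (1 - x)" using x by (subst geometric_sum) (auto simp: field_simps)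
    also have "\<dots> \<le> 1 / (1 - x)" using x by (intro divide_right_mono) auto
    finally show "(\<Sum>i<N. x ^ i) \<le> 1 / (1 - x)" .
    show "(\<Sum>d\<in>A P. real d powr - s) \<le> (\<Prod>l\<in>P. 1 / (1 - real l powr - s))"
      unfolding A_def using insert by auto
  qed (use x in \<open>auto intro: sum_nonneg\<close>)
  finally show ?case using insert by (simp add: A_def x_def)
qed

text \<open>An integral comparison in algebraic form: for the fourth roots \<open>a\<close> and
  \<open>b\<close> of \<open>N + 1\<close> and \<open>N\<close>, the identity
  \<open>a ^ 4 - b ^ 4 = 1\<close> gives \<open>1 / a ^ 3 \<le> 4 * (a - b)\<close>, which
  telescopes.\<close>

lemma sum_powr_three_quarters_le: "(\<Sum>n=1..N. real n powr (- 3 / 4)) \<le> 4 * real N powr (1 / 4)"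
proof (induction N)
  case (Suc N)
  define a b where "a = real (Suc N) powr (1 / 4)" and "b = real N powr (1 / 4)"
  have ab: "a > 0" "0 \<le> b" "b \<le> a" by (auto simp: a_def b_def intro: powr_mono2)
  have pow4: "(x powr (1 / 4)) ^ 4 = x" if "x \<ge> 0" for x :: real
    using that by (cases "x = 0") (auto simp: powr_power)
  have a4: "a ^ 4 = real (Suc N)" "b ^ 4 = real N" unfolding a_def b_def by (simp_all only: pow4 of_nat_0_le_iff)
  have a3: "real (Suc N) powr (- 3 / 4) = 1 / a ^ 3"
    by (simp add: a_def powr_power powr_minus_divide)
  have "1 = a ^ 4 - b ^ 4" using a4 by simp
  also have "\<dots> = (a - b) * (a ^ 3 + a\<^sup>2 * b + a * b\<^sup>2 + b ^ 3)"
    by (simp add: power2_eq_square power3_eq_cube power4_eq_xxxx algebra_simps)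
  also have "\<dots> \<le> (a - b) * (4 * a ^ 3)"
  proof (rule mult_left_mono)
    have "a\<^sup>2 * b \<le> a\<^sup>2 * a" "a * b\<^sup>2 \<le> a * a\<^sup>2" "b ^ 3 \<le> a ^ 3"
      using ab by (auto intro!: mult_left_mono power_mono)
    then show "a ^ 3 + a\<^sup>2 * b + a * b\<^sup>2 + b ^ 3 \<le> 4 * a ^ 3"
      by (simp add: power2_eq_square power3_eq_cube)
  qed (use ab in auto)
  finally have "1 / a ^ 3 \<le> 4 * (a - b)" using ab by (simp add: field_simps)
  then have "(\<Sum>n=1..N. real n powr (- 3 / 4)) + 1 / a ^ 3 \<le> 4 * b + 4 * (a - b)"
    using Suc.IH[folded b_def] by (intro add_mono)
  then have "(\<Sum>n=1..N. real n powr (- 3 / 4)) + 1 / a ^ 3 \<le> 4 * a" by simp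
  then show ?case by (simp add: a3[symmetric] del: of_nat_Suc flip: a_def)
qed simp

text \<open>Each Euler factor \<open>1 / (1 - x)\<close> with \<open>x = l powr (- 3 / 4)\<close> is
  at most \<open>exp (3 * x)\<close>. Enlarging the sum over primes to all integers up to
  \<open>z\<close> costs the factor 4 in the constant \<open>12 = 3 * 4\<close>.\<close>

lemma sum_powr_smooth_le_exp:
  "(\<Sum>d | d \<in> {1..N} \<and> (\<forall>l\<in>prime_factors d. l \<le> z). real d powr (- 3 / 4)) \<le> exp (12 * real z powr (1 / 4))"
proof -
  define P where "P = {l. prime l \<and> l \<le> z}"
  have P: "finite P" "\<And>l. l \<in> P \<Longrightarrow> prime l" "P \<subseteq> {1..z}"
    by (auto simp: P_def dest: prime_ge_1_nat)
  have "{d. d \<in> {1..N} \<and> (\<forall>l\<in>prime_factors d. l \<le> z)} = {d. d \<in> {1..N} \<and> prime_factors d \<subseteq> P}"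
    by (auto simp: P_def in_prime_factors_iff)
  then have "(\<Sum>d | d \<in> {1..N} \<and> (\<forall>l\<in>prime_factors d. l \<le> z). real d powr (- 3 / 4))
    \<le> (\<Prod>l\<in>P. 1 / (1 - real l powr (- 3 / 4)))"
    using sum_powr_smooth_le[OF P(1,2), of "3 / 4" N] by simp
  also have "\<dots> \<le> (\<Prod>l\<in>P. exp (3 * real l powr (- 3 / 4)))"
  proof (rule prod_mono)
    fix l assume "l \<in> P"
    then have l: "real l \<ge> 2" using P(2) prime_ge_2_nat by fastforce
    define x where "x = real l powr (- 3 / 4)"
    have "x \<le> 2 powr (- 3 / 4)" unfolding x_def using l by (intro powr_mono2') auto
    \<comment> \<open>Compared through fourth powers: \<open>1 / 8 \<le> 16 / 81\<close>.\<close>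
    also have "2 powr (- 3 / 4 :: real) \<le> 2 / 3"
    proof -
      have "(2 powr (- 3 / 4 :: real)) ^ 4 = 2 powr - 3" by (subst powr_power) auto
      also have "\<dots> = 1 / 8" by (simp add: powr_minus_divide)
      also have "\<dots> \<le> (2 / 3) ^ 4" by (simp add: power4_eq_xxxx)
      finally show ?thesis using power_mono_iff[of "2 powr (- 3 / 4 :: real)" "2 / 3" 4] by simp
    qed
    finally have x: "0 \<le> x" "x \<le> 2 / 3" by (auto simp: x_def)
    have "1 / (1 - x) = 1 + x / (1 - x)" using x by (simp add: field_simps)
    also have "x / (1 - x) \<le> x / (1 / 3)" using x by (intro divide_left_mono) auto
    also have "1 + x / (1 / 3) \<le> exp (3 * x)" using exp_ge_add_one_self[of "3 * x"] by (simp add: mult.commute)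
    finally show "0 \<le> 1 / (1 - real l powr (- 3 / 4)) \<and>
        1 / (1 - real l powr (- 3 / 4)) \<le> exp (3 * real l powr (- 3 / 4))"
      using x by (simp add: x_def)
  qed
  also have "\<dots> = exp (3 * (\<Sum>l\<in>P. real l powr (- 3 / 4)))"
    using P(1) by (simp add: exp_sum sum_distrib_left)
  also have "\<dots> \<le> exp (3 * (\<Sum>n=1..z. real n powr (- 3 / 4)))"
    using P(3) by (auto intro!: sum_mono2)
  also have "\<dots> \<le> exp (12 * real z powr (1 / 4))"
    using sum_powr_three_quarters_le[of z] by simp
  finally show ?thesis .
qed

text \<open>The cube balances two needs: \<open>linked_block_sum_le\<close> requires an exponent above 2 to be
  summable over \<open>j\<close>, while in \<open>large_smooth_part_block_sum_le\<close> the fourth root of the threshold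
  has to be of smaller order than \<open>log n\<close>.\<close>

definition smooth_threshold :: "nat \<Rightarrow> nat" where
  "smooth_threshold n = floor_log n ^ 3"

text \<open>\<open>n < d ^ 8\<close> expresses that \<open>d\<close> exceeds the eighth root of
  \<open>n\<close>. For \<open>n \<ge> 2\<close> the smooth part of \<open>n - 1\<close> is its
  largest smooth divisor, so asking for some such \<open>d\<close> is the same as asking it of the
  smooth part.\<close>

definition large_smooth_part :: "nat \<Rightarrow> bool" where
  "large_smooth_part n \<longleftrightarrow> (\<exists>d. d dvd n - 1 \<and> (\<forall>l\<in>prime_factors d. l \<le> smooth_threshold n) \<and> n < d ^ 8)"

definition linked :: "nat \<Rightarrow> nat \<Rightarrow> bool" where
  "linked n q \<longleftrightarrow> (\<exists>l > smooth_threshold n. l dvd n - 1 \<and> l dvd q - 1)"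

section \<open>Reciprocals of exceptional divisors in one dyadic block\<close>

lemma floor_log_eq: "n \<in> {2 ^ j..<2 ^ Suc j} \<Longrightarrow> floor_log n = j"
proof -
  assume n: "n \<in> {2 ^ j..<2 ^ Suc j}"
  then have "n > 0" by (auto intro: Nat.gr0I)
  then have "(2::nat) ^ floor_log n < 2 ^ Suc j" using n floor_log_exp2_le[of n] by auto
  then have "floor_log n < Suc j" by (rule power_less_imp_less_exp[rotated]) simp
  moreover have "j \<le> floor_log n" using n floor_log_le_iff[of "2 ^ j" n] by simp
  ultimately show ?thesis by simp
qed

text \<open>For each common divisor \<open>l > j ^ 3\<close>, the \<open>n\<close> in the block
  contribute at most \<open>2 / l\<close> and the \<open>q\<close> at most
  \<open>(j + 2) / l\<close>; the tail of the inverse squares then gives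
  \<open>1 / j ^ 3\<close>.\<close>

lemma linked_block_sum_le:
  assumes "j > 0"
  shows "(\<Sum>n\<in>{2 ^ j..<2 ^ Suc j}. \<Sum>q | q \<in> {2..<n} \<and> linked n q. 1 / (real n * real q)) \<le> 2 * (j + 2) / j ^ 3"
proof -
  let ?I = "{2 ^ j..<2 ^ Suc j :: nat}" and ?Q = "{2..<2 ^ Suc j :: nat}" and ?L = "{j ^ 3<..2 ^ Suc j :: nat}"
  let ?f = "\<lambda>l n. if l dvd n - 1 then 1 / real n else 0"
  have "(\<Sum>q | q \<in> {2..<n} \<and> linked n q. 1 / (real n * real q)) \<le> (\<Sum>q\<in>?Q. \<Sum>l\<in>?L. ?f l n * ?f l q)"
    if n: "n \<in> ?I" for n
  proof -
    have z: "smooth_threshold n = j ^ 3" using floor_log_eq[OF n] by (simp add: smooth_threshold_def)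
    have "(\<Sum>q | q \<in> {2..<n} \<and> linked n q. 1 / (real n * real q)) \<le>
          (\<Sum>q | q \<in> {2..<n} \<and> linked n q. \<Sum>l\<in>?L. ?f l n * ?f l q)"
    proof (rule sum_mono)
      fix q assume q: "q \<in> {q. q \<in> {2..<n} \<and> linked n q}"
      then obtain l where l: "l > j ^ 3" "l dvd n - 1" "l dvd q - 1" by (auto simp: linked_def z)
      then have "l \<le> q - 1" using q by (intro dvd_imp_le) auto
      then have "l \<in> ?L" using l q n by auto
      then have "?f l n * ?f l q \<le> (\<Sum>l\<in>?L. ?f l n * ?f l q)" by (intro member_le_sum) auto
      then show "1 / (real n * real q) \<le> (\<Sum>l\<in>?L. ?f l n * ?f l q)" using l by simp
    qed
    also have "\<dots> \<le> (\<Sum>q\<in>?Q. \<Sum>l\<in>?L. ?f l n * ?f l q)"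
      using n by (intro sum_mono2) (auto intro!: sum_nonneg)
    finally show ?thesis .
  qed
  then have "(\<Sum>n\<in>?I. \<Sum>q | q \<in> {2..<n} \<and> linked n q. 1 / (real n * real q)) \<le>
      (\<Sum>n\<in>?I. \<Sum>q\<in>?Q. \<Sum>l\<in>?L. ?f l n * ?f l q)"
    by (rule sum_mono)
  also have "\<dots> = (\<Sum>l\<in>?L. (\<Sum>n\<in>?I. ?f l n) * (\<Sum>q\<in>?Q. ?f l q))"
    unfolding sum_product by (subst sum.swap[of _ ?L ?Q], subst sum.swap[of _ ?L ?I]) (rule refl)
  also have "\<dots> \<le> (\<Sum>l\<in>?L. 2 * (j + 2) * (1 / (real l)\<^sup>2))"
  proof (rule sum_mono)
    fix l assume "l \<in> ?L"
    then have l: "l > 0" by auto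
    have "(\<Sum>n\<in>?I. ?f l n) \<le> 2 / l"
      using sum_inverse_progression_block_le[OF l assms] by (simp add: sum.If_cases Int_def)
    moreover have "(\<Sum>q\<in>?Q. ?f l q) \<le> (j + 2) / l"
    proof -
      have "(\<Sum>q\<in>?Q. ?f l q) \<le> harm (2 ^ Suc j) / l"
        using sum_inverse_progression_le[OF l, of "2 ^ Suc j"] by (simp add: sum.If_cases Int_def)
      also have "\<dots> \<le> (j + 2) / l"
        using harm_pow2_le[of "Suc j"] by (intro divide_right_mono) auto
      finally show ?thesis .
    qed
    ultimately have "(\<Sum>n\<in>?I. ?f l n) * (\<Sum>q\<in>?Q. ?f l q) \<le> (2 / l) * ((j + 2) / l)"
      by (intro mult_mono) (auto intro!: sum_nonneg)
    then show "(\<Sum>n\<in>?I. ?f l n) * (\<Sum>q\<in>?Q. ?f l q) \<le> 2 * (j + 2) * (1 / (real l)\<^sup>2)"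
      by (simp add: power2_eq_square)
  qed
  also have "\<dots> = 2 * (j + 2) * (\<Sum>l\<in>?L. 1 / (real l)\<^sup>2)" by (simp add: sum_distrib_left)
  also have "\<dots> \<le> 2 * (j + 2) * (1 / real (j ^ 3))"
    using assms by (intro mult_left_mono sum_inverse_squares_tail_le) auto
  finally show ?thesis by (simp add: algebra_simps add_divide_distrib)
qed

text \<open>For the smooth \<open>d\<close> with \<open>2 ^ j < d ^ 8\<close>, the weight
  \<open>1 / d\<close> splits as \<open>d powr (- 1 / 4) * d powr (- 3 / 4)\<close>. The first
  factor is at most \<open>2 powr (- j / 32)\<close>, and the second is summed over all smooth
  \<open>d\<close>.\<close>

lemma large_smooth_part_block_sum_le:
  assumes "j > 0"
  shows "(\<Sum>n\<in>{2 ^ j..<2 ^ Suc j}. if large_smooth_part n then 1 / real n else 0) \<le>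
         2 * 2 powr (- real j / 32) * exp (12 * real (j ^ 3) powr (1 / 4))"
proof -
  let ?I = "{2 ^ j..<2 ^ Suc j :: nat}" and ?S = "{d. d \<in> {1..2 ^ Suc j} \<and> (\<forall>l\<in>prime_factors d. l \<le> j ^ 3)}"
  let ?D = "{d \<in> ?S. 2 ^ j < d ^ 8}"
  let ?f = "\<lambda>d n. if d dvd n - 1 then 1 / real n else 0"
  have "(\<Sum>n\<in>?I. if large_smooth_part n then 1 / real n else 0) \<le> (\<Sum>n\<in>?I. \<Sum>d\<in>?D. ?f d n)"
  proof (rule sum_mono)
    fix n assume n: "n \<in> ?I"
    have z: "smooth_threshold n = j ^ 3" using floor_log_eq[OF n] by (simp add: smooth_threshold_def)
    show "(if large_smooth_part n then 1 / real n else 0) \<le> (\<Sum>d\<in>?D. ?f d n)"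
    proof (cases "large_smooth_part n")
      case True
      then obtain d where d: "d dvd n - 1" "\<forall>l\<in>prime_factors d. l \<le> j ^ 3" "n < d ^ 8"
        by (auto simp: large_smooth_part_def z)
      have "2 \<le> (2::nat) ^ j" using assms self_le_power[of 2 j] by simp
      then have n2: "n \<ge> 2" using n by simp
      then have "d \<le> n - 1" "d > 0" using d(1) by (auto intro!: dvd_imp_le Nat.gr0I)
      then have "d \<in> ?D" using d n by auto
      then have "?f d n \<le> (\<Sum>d\<in>?D. ?f d n)" by (intro member_le_sum) auto
      with True d show ?thesis by simp
    qed (auto intro!: sum_nonneg)
  qed
  also have "\<dots> = (\<Sum>d\<in>?D. \<Sum>n\<in>?I. ?f d n)" by (rule sum.swap)
  also have "\<dots> \<le> (\<Sum>d\<in>?D. 2 * 2 powr (- real j / 32) * real d powr (- 3 / 4))"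
  proof (rule sum_mono)
    fix d assume d: "d \<in> ?D"
    then have d0: "d > 0" by auto
    have "(\<Sum>n\<in>?I. ?f d n) \<le> 2 / d"
      using sum_inverse_progression_block_le[OF d0 assms] by (simp add: sum.If_cases Int_def)
    also have "2 / real d = 2 * real d powr (- 1 / 4) * real d powr (- 3 / 4)"
      using d0 by (simp add: mult.assoc powr_minus_divide flip: powr_add)
    also have "\<dots> \<le> 2 * 2 powr (- real j / 32) * real d powr (- 3 / 4)"
    proof (intro mult_right_mono mult_left_mono)
      have "real (2 ^ j) \<le> real (d ^ 8)" using d by (intro of_nat_mono) auto
      then have "2 powr real j \<le> real d powr 8" using d0 by (simp add: powr_realpow)
      then have "(2 powr real j) powr (1 / 32) \<le> (real d powr 8) powr (1 / 32)"
        by (intro powr_mono2) auto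
      then have "2 powr (real j / 32) \<le> real d powr (1 / 4)"
        unfolding powr_powr by simp
      then show "real d powr (- 1 / 4) \<le> 2 powr (- real j / 32)"
        using d0 by (simp add: powr_minus_divide frac_le)
    qed auto
    finally show "(\<Sum>n\<in>?I. ?f d n) \<le> 2 * 2 powr (- real j / 32) * real d powr (- 3 / 4)" .
  qed
  also have "\<dots> \<le> (\<Sum>d\<in>?S. 2 * 2 powr (- real j / 32) * real d powr (- 3 / 4))"
    by (intro sum_mono2) auto
  also have "\<dots> = 2 * 2 powr (- real j / 32) * (\<Sum>d\<in>?S. real d powr (- 3 / 4))"
    by (simp add: sum_distrib_left)
  also have "\<dots> \<le> 2 * 2 powr (- real j / 32) * exp (12 * real (j ^ 3) powr (1 / 4))"
    by (intro mult_left_mono sum_powr_smooth_le_exp) auto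
  finally show ?thesis .
qed

text \<open>An upper bound for the sum of \<open>1 / b\<close> over \<open>b\<close> in
  \<open>exceptional n\<close>. Both \<open>n\<close> and \<open>q\<close> range over all integers
  instead of primes; the series converges all the same.\<close>

definition exceptional_weight :: "nat \<Rightarrow> real" where
  "exceptional_weight n = 1 / (real n)\<^sup>2 + (if large_smooth_part n then 1 / real n else 0) +
     (\<Sum>q | q \<in> {2..<n} \<and> linked n q. 1 / (real n * real q))"

lemma summable_if_eventually_le_inverse_square:
  fixes B :: "nat \<Rightarrow> real"
  assumes "eventually (\<lambda>j. \<bar>B j\<bar> \<le> C / (real j)\<^sup>2) sequentially"
  shows "summable B"
proof (rule summable_comparison_test_ev)
  show "eventually (\<lambda>j. norm (B j) \<le> C * inverse ((real j)\<^sup>2)) sequentially"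
    using assms by (simp add: divide_inverse)
  show "summable (\<lambda>j. C * inverse ((real j)\<^sup>2))"
    using inverse_power_summable[of 2, where 'a = real] by (intro summable_mult) auto
qed

lemma summable_exceptional_weight: "summable exceptional_weight"
proof -
  define f where "f n = (if large_smooth_part n then 1 / real n else 0)" for n
  define g where "g n = (\<Sum>q | q \<in> {2..<n} \<and> linked n q. 1 / (real n * real q))" for n
  \<comment> \<open>The block bounds assume \<open>j > 0\<close>, so the block \<open>j = 0\<close>
    serves as its own bound, here and in \<open>H\<close>.\<close>
  define F where "F j = (if j = 0 then \<Sum>n\<in>{2 ^ j..<2 ^ Suc j}. f n
      else 2 * 2 powr (- real j / 32) * exp (12 * real (j ^ 3) powr (1 / 4)))" for j :: nat
  define H where "H j = (if j = 0 then \<Sum>n\<in>{2 ^ j..<2 ^ Suc j}. g n else 2 * (real j + 2) / real j ^ 3)" for j :: nat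
  have "summable f"
  proof (rule summable_if_dyadic_block_bound)
    show "(\<Sum>n\<in>{2 ^ j..<2 ^ Suc j}. f n) \<le> F j" for j
      unfolding F_def f_def using large_smooth_part_block_sum_le[of j] by auto
    \<comment> \<open>The exponent is a constant times \<open>j powr (3 / 4)\<close>, of lower order
      than \<open>j / 32 * ln 2\<close>.\<close>
    have "eventually (\<lambda>j::nat. 2 * 2 powr (- real j / 32) * exp (12 * (real j ^ 3) powr (1 / 4)) \<le> 1 / (real j)\<^sup>2) sequentially"
      by real_asymp
    then have "eventually (\<lambda>j. \<bar>F j\<bar> \<le> 1 / (real j)\<^sup>2) sequentially"
      using eventually_gt_at_top[of 0] by eventually_elim (auto simp: F_def)
    then show "summable F" by (rule summable_if_eventually_le_inverse_square)
  qed (simp add: f_def)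
  moreover have "summable g"
  proof (rule summable_if_dyadic_block_bound)
    show "(\<Sum>n\<in>{2 ^ j..<2 ^ Suc j}. g n) \<le> H j" for j
      unfolding H_def g_def using linked_block_sum_le[of j] by (auto simp: add_ac)
    have "eventually (\<lambda>j::nat. 2 * (real j + 2) / real j ^ 3 \<le> 3 / (real j)\<^sup>2) sequentially"
      by real_asymp
    then have "eventually (\<lambda>j. \<bar>H j\<bar> \<le> 3 / (real j)\<^sup>2) sequentially"
      using eventually_gt_at_top[of 0] by eventually_elim (auto simp: H_def)
    then show "summable H" by (rule summable_if_eventually_le_inverse_square)
  qed (auto simp: g_def intro!: sum_nonneg)
  moreover have "summable (\<lambda>n. 1 / (real n)\<^sup>2)"
    by (rule summable_if_eventually_le_inverse_square[of _ 1]) auto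
  ultimately have "summable (\<lambda>n. 1 / (real n)\<^sup>2 + f n + g n)" by (intro summable_add)
  then show ?thesis unfolding exceptional_weight_def f_def g_def .
qed

subsection \<open>Goodness without exceptional divisors\<close>

lemma smooth_rough_decomposition:
  fixes n z :: nat
  assumes "n > 0"
  shows "\<exists>d e. n = d * e \<and> (\<forall>l\<in>prime_factors d. l \<le> z) \<and> (\<forall>l\<in>prime_factors e. l > z)"
  using assms
proof (induction n rule: prime_divisors_induct)
  case (unit n)
  then show ?case by (intro exI[of _ 1]) auto
next
  case (factor q n)
  then have "n > 0" by (auto intro!: Nat.gr0I)
  then obtain d e where de: "n = d * e" "\<forall>l\<in>prime_factors d. l \<le> z" "\<forall>l\<in>prime_factors e. l > z"
    using factor by blast
  have nz: "d \<noteq> 0" "e \<noteq> 0" "q \<noteq> 0" using de(1) \<open>n > 0\<close> factor by auto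
  show ?case
  proof (cases "q \<le> z")
    case True
    then show ?thesis using de factor nz
      by (intro exI[of _ "q * d"] exI[of _ e]) (auto simp: prime_factors_product prime_prime_factors)
  next
    case False
    then show ?thesis using de factor nz
      by (intro exI[of _ d] exI[of _ "q * e"]) (auto simp: prime_factors_product prime_prime_factors)
  qed
qed simp

lemma pow2_card_prime_factors_le:
  fixes e :: nat
  assumes "e > 0"
  shows "2 ^ card (prime_factors e) \<le> e"
proof -
  have "(2::nat) ^ card (prime_factors e) = (\<Prod>l\<in>prime_factors e. 2)" by simp
  also have "\<dots> \<le> (\<Prod>l\<in>prime_factors e. l ^ multiplicity l e)"
  proof (rule prod_mono)
    fix l assume l: "l \<in> prime_factors e"
    then have "2 \<le> l" by (auto simp: in_prime_factors_iff prime_ge_2_nat)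
    also have "l \<le> l ^ multiplicity l e"
      using l by (intro self_le_power) (auto simp: prime_factors_multiplicity Suc_le_eq prime_gt_0_nat)
    finally show "0 \<le> (2::nat) \<and> 2 \<le> l ^ multiplicity l e" by simp
  qed
  also have "\<dots> = e" using prime_factorization_nat[OF assms] by simp
  finally show ?thesis .
qed

text \<open>As \<open>d\<close> is at most \<open>p powr (1 / 8)\<close>, the cofactor
  \<open>e\<close> is at least \<open>p powr (7 / 8) / 2\<close>, so \<open>e\<^sup>2 / p\<close> is
  at least \<open>p powr (3 / 4) / 4\<close>. Roughness keeps the sum of the \<open>1 / l\<close>
  below \<open>1 / 2\<close>, and \<open>e\<close> has at most \<open>log 2 p\<close> prime factors,
  so the left-hand side is only of order \<open>sqrt p * log 2 p\<close>.\<close>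

lemma eventually_generator_bound:
  "eventually (\<lambda>p::nat. \<forall>d e. p - 1 = d * e \<longrightarrow> d ^ 8 \<le> p \<longrightarrow>
      (\<forall>l\<in>prime_factors e. l > smooth_threshold p) \<longrightarrow>
      (1 + card (prime_factors e)) * sqrt p < (real e)\<^sup>2 / real p * (1 - (\<Sum>l\<in>prime_factors e. 1 / real l)))
    sequentially"
proof -
  \<comment> \<open>The 8 is the product of the 4 from
    \<open>(p - 1)\<^sup>2 \<ge> p\<^sup>2 / 4\<close> and the 2 from the reciprocal sum.\<close>
  have "eventually (\<lambda>p::nat. real p powr (1 / 4) > 8 * (1 + log 2 p)) sequentially" by real_asymp
  then show ?thesis using eventually_ge_at_top[of 4]
  proof eventually_elim
    case (elim p)
    show ?case
    proof (intro allI impI)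
      fix d e assume de: "p - 1 = d * e" and d8: "d ^ 8 \<le> p"
        and rough: "\<forall>l\<in>prime_factors e. l > smooth_threshold p"
      define j where "j = floor_log p"
      have p: "p \<ge> 4" using elim by simp
      have d0: "d > 0" and e0: "e > 0" using de p by (auto intro!: Nat.gr0I)
      have j2: "j \<ge> 2" using floor_log_le_iff[OF p] floor_log_power[of 2] by (simp add: j_def)
      have "2 ^ j \<le> p" using p by (simp add: j_def floor_log_exp2_le)
      then have jlog: "real j \<le> log 2 p" using le_log_of_power[of 2 j p] by simp
      have "(2::nat) ^ card (prime_factors e) \<le> e" using e0 by (rule pow2_card_prime_factors_le)
      also have "e \<le> p - 1" using de d0 by simp
      also have "\<dots> < 2 ^ Suc j" using floor_log_exp2_gt[of p] by (simp add: j_def)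
      finally have "card (prime_factors e) < Suc j" by (rule power_less_imp_less_exp[rotated]) simp
      then have omega: "card (prime_factors e) \<le> j" by simp
      have "(\<Sum>l\<in>prime_factors e. 1 / real l) \<le> (\<Sum>l\<in>prime_factors e. 1 / real j ^ 3)"
      proof (rule sum_mono)
        fix l assume "l \<in> prime_factors e"
        then have "real (j ^ 3) \<le> real l" using rough by (intro of_nat_mono) (auto simp: smooth_threshold_def j_def less_imp_le)
        then show "1 / real l \<le> 1 / real j ^ 3" using j2 by (intro frac_le) auto
      qed
      also have "\<dots> = card (prime_factors e) * (1 / real j ^ 3)" by simp
      also have "\<dots> \<le> real j * (1 / real j ^ 3)" using omega by (intro mult_right_mono) auto
      also have "\<dots> = 1 / (real j)\<^sup>2" using j2 by (simp add: power2_eq_square power3_eq_cube)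
      also have "\<dots> \<le> 1 / 2\<^sup>2" using j2 by (intro divide_left_mono power_mono) auto
      finally have recip: "1 / 2 \<le> 1 - (\<Sum>l\<in>prime_factors e. 1 / real l)" by simp

      define r where "r = real p powr (1 / 4)"
      have r0: "r > 0" using p by (simp add: r_def)
      have r4: "r ^ 4 = p" using p by (simp add: r_def powr_power)
      have rr: "sqrt p = r\<^sup>2" using p by (simp add: r_def powr_power powr_half_sqrt)
      have "((real d)\<^sup>2) ^ 4 \<le> r ^ 4"
        using d8 unfolding r4 by (simp flip: power_mult of_nat_power)
      then have dr: "(real d)\<^sup>2 \<le> r" by (subst (asm) power_mono_iff) (use r0 in auto)
      have "real d * real e = real p - 1" using de p by (simp flip: of_nat_mult add: of_nat_diff)
      then have "real p / 2 \<le> real d * real e" using p by simp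
      then have "(real p / 2)\<^sup>2 \<le> (real d * real e)\<^sup>2" by (intro power_mono) auto
      also have "\<dots> = (real d)\<^sup>2 * (real e)\<^sup>2" by (simp add: power_mult_distrib)
      also have "\<dots> \<le> r * (real e)\<^sup>2" using dr by (intro mult_right_mono) auto
      finally have "(r ^ 4)\<^sup>2 / 4 \<le> r * (real e)\<^sup>2" by (simp add: r4 power_divide)
      then have "r * (r ^ 7 / 4) \<le> r * (real e)\<^sup>2" by (simp add: eval_nat_numeral mult_ac)
      then have "r ^ 7 / 4 \<le> (real e)\<^sup>2" using r0 by simp
      then have "r ^ 7 / 4 / r ^ 4 \<le> (real e)\<^sup>2 / p" unfolding r4[symmetric] using r0 by (intro divide_right_mono) auto
      then have main: "r ^ 3 / 4 \<le> (real e)\<^sup>2 / p" using r0 by (simp add: eval_nat_numeral)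
      have "8 * (1 + card (prime_factors e)) < r"
        using elim(1) omega jlog by (simp add: r_def)
      then have "(1 + real (card (prime_factors e))) * r\<^sup>2 < (r / 8) * r\<^sup>2"
        using r0 by (intro mult_strict_right_mono) auto
      also have "\<dots> = r ^ 3 / 4 * (1 / 2)" by (simp add: power2_eq_square power3_eq_cube)
      also have "\<dots> \<le> (real e)\<^sup>2 / p * (1 - (\<Sum>l\<in>prime_factors e. 1 / real l))"
        using main recip r0 by (intro mult_mono) auto
      finally show "(1 + card (prime_factors e)) * sqrt p < (real e)\<^sup>2 / real p * (1 - (\<Sum>l\<in>prime_factors e. 1 / real l))"
        by (simp add: rr)
    qed
  qed
qed

text \<open>For squarefree \<open>m\<close> the totient is the product of \<open>q - 1\<close> over
  the primes \<open>q\<close> dividing \<open>m\<close>.\<close>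

lemma prime_dvd_totient_squarefree:
  assumes "prime l" "l dvd totient m" "m > 0" "\<And>q. prime q \<Longrightarrow> \<not> q\<^sup>2 dvd m"
  shows "\<exists>q\<in>prime_factors m. l dvd q - 1"
proof -
  have "totient m = (\<Prod>q\<in>prime_factors m. q ^ (multiplicity q m - 1) * (q - 1))"
    by (rule totient_formula1[OF assms(3)])
  also have "\<dots> = (\<Prod>q\<in>prime_factors m. q - 1)"
  proof (intro prod.cong refl)
    fix q assume "q \<in> prime_factors m"
    then have "prime q" by auto
    then have "multiplicity q m < 2"
      using assms(3,4) power_dvd_iff_le_multiplicity[of m q 2] by fastforce
    then have "multiplicity q m - 1 = 0" by simp
    then show "q ^ (multiplicity q m - 1) * (q - 1) = q - 1" by simp
  qed
  finally show ?thesis using assms(1,2) by (simp add: prime_dvd_prod_iff)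
qed

text \<open>The index \<open>n\<close> stands for the larger prime of the obstruction, so
  restricting to \<open>n > y\<close> leaves a tail of the series of
  \<open>exceptional_weight\<close>.\<close>

definition exceptional :: "nat \<Rightarrow> nat set" where
  "exceptional n = {n\<^sup>2} \<union> {b. b = n \<and> large_smooth_part n} \<union> {n * q | q. q \<in> {2..<n} \<and> linked n q}"

text \<open>Strong induction on \<open>m\<close>, removing its largest prime \<open>p\<close>.
  Absence of squares makes \<open>m\<close> squarefree, absence of \<open>large_smooth_part\<close>
  bounds the smooth factor \<open>d\<close> of \<open>p - 1\<close>, and absence of
  \<open>linked\<close> pairs makes the rough factor \<open>e\<close> coprime to
  \<open>totient m'\<close>. All hypotheses pass to the divisor \<open>m'\<close>.\<close>

lemma eventually_good_if_no_exceptional_divisor: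
  "eventually (\<lambda>y. \<forall>m>0. (\<forall>p\<in>prime_factors m. y < p) \<longrightarrow>
     (\<forall>n>y. \<forall>b\<in>exceptional n. \<not> b dvd m) \<longrightarrow> good m) sequentially"
proof -
  obtain y0 where y0: "\<And>p d e. p \<ge> y0 \<Longrightarrow> p - 1 = d * e \<Longrightarrow> d ^ 8 \<le> p \<Longrightarrow>
      (\<forall>l\<in>prime_factors e. l > smooth_threshold p) \<Longrightarrow>
      (1 + card (prime_factors e)) * sqrt p < (real e)\<^sup>2 / real p * (1 - (\<Sum>l\<in>prime_factors e. 1 / real l))"
    using eventually_generator_bound unfolding eventually_sequentially by meson
  \<comment> \<open>\<open>y0\<close> makes the generator bound available for every prime above
    \<open>y\<close>, and 2 makes these primes odd.\<close>
  show ?thesis using eventually_ge_at_top[of "max y0 2"]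
  proof eventually_elim
    case (elim y)
    have "good m" if "m > 0" "\<forall>p\<in>prime_factors m. y < p" "\<forall>n>y. \<forall>b\<in>exceptional n. \<not> b dvd m" for m
      using that
    proof (induction m rule: less_induct)
      case (less m)
      show ?case
      proof (cases "m = 1")
        case True
        then show ?thesis by (simp add: good_1[unfolded One_nat_def])
      next
        case False
        define p where "p = Max (prime_factors m)"
        have "prime_factors m \<noteq> {}" using False less.prems(1) by (auto simp: prime_factorization_empty_iff)
        then have pm: "p \<in> prime_factors m" and pmax: "\<And>q. q \<in> prime_factors m \<Longrightarrow> q \<le> p"
          by (auto simp: p_def)
        then have p: "prime p" "p dvd m" "y < p" using less.prems by auto
        define m' where "m' = m div p"
        have m: "m = p * m'" using p by (simp add: m'_def)
        have sq: "\<not> q\<^sup>2 dvd m" if "prime q" for q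
        proof
          assume q: "q\<^sup>2 dvd m"
          then have "q dvd m" by (metis dvd_power dvd_trans pos2)
          then have "y < q" using that less.prems by (auto simp: in_prime_factors_iff)
          then show False using less.prems(3) q by (auto simp: exceptional_def)
        qed
        have pm': "\<not> p dvd m'" using sq[OF p(1)] by (simp add: m power2_eq_square)
        have m'0: "m' > 0" using m less.prems by (auto intro!: Nat.gr0I)
        have pf: "prime_factors m' \<subseteq> prime_factors m"
          using m less.prems(1) by (intro dvd_prime_factors) auto
        have good: "good m'"
        proof (rule less.IH)
          show "m' < m" using m m'0 p prime_gt_1_nat[of p] by simp
          show "\<forall>n>y. \<forall>b\<in>exceptional n. \<not> b dvd m'" using less.prems(3) m by (meson dvd_mult)
        qed (use m'0 pf less.prems in auto)
        obtain d e where de: "p - 1 = d * e" "\<forall>l\<in>prime_factors d. l \<le> smooth_threshold p"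
            "\<forall>l\<in>prime_factors e. l > smooth_threshold p"
          using smooth_rough_decomposition[of "p - 1" "smooth_threshold p"] prime_gt_1_nat[OF p(1)] by auto
        have "\<not> large_smooth_part p"
          using less.prems(3) p by (auto simp: exceptional_def)
        then have d8: "d ^ 8 \<le> p" using de unfolding large_smooth_part_def by (metis dvd_triv_left not_less)
        have e0: "e > 0" using de prime_gt_1_nat[OF p(1)] by (auto intro!: Nat.gr0I)
        \<comment> \<open>A common prime \<open>l\<close> exceeds the threshold because it divides
          \<open>e\<close>, and it divides \<open>q - 1\<close> for some prime \<open>q < p\<close>
          of \<open>m'\<close>; then \<open>p * q\<close> is an exceptional divisor of
          \<open>m\<close>.\<close>
        have "coprime e (totient m')"
        proof (rule ccontr)
          assume "\<not> coprime e (totient m')"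
          then obtain l where l: "prime l" "l dvd e" "l dvd totient m'"
            using not_coprimeE prime_factor_nat
            by (metis coprime_iff_gcd_eq_1 gcd_nat.boundedE)
          have "\<not> q\<^sup>2 dvd m'" if "prime q" for q using sq[OF that] m by (metis dvd_mult)
          then obtain q where q: "q \<in> prime_factors m'" "l dvd q - 1"
            using prime_dvd_totient_squarefree[OF l(1,3) m'0] by blast
          have "q \<noteq> p" using q pm' by (auto simp: in_prime_factors_iff)
          then have "q < p" using pmax[of q] q pf by auto
          moreover have "q \<ge> 2" using q by (auto simp: in_prime_factors_iff prime_ge_2_nat)
          moreover have "linked p q"
            unfolding linked_def using l q de e0 by (intro exI[of _ l]) (auto simp: in_prime_factors_iff)
          ultimately have "p * q \<in> exceptional p" by (auto simp: exceptional_def)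
          moreover have "p * q dvd m" using q m by (auto simp: in_prime_factors_iff)
          ultimately show False using less.prems(3) p(3) by blast
        qed
        moreover have "odd p" using p elim prime_odd_nat by auto
        moreover have "\<exists>(x::int) j. coprime x (int p) \<and> [x ^ e = 1] (mod int p) \<and> [x ^ j * (x - 1) = a] (mod int p)"
          if "\<not> int p dvd a" for a
        proof (rule exists_solution_of_order[OF p(1) _ that])
          show "e dvd p - 1" using de by simp
          show "(1 + card (prime_factors e)) * sqrt p < (real e)\<^sup>2 / real p * (1 - (\<Sum>l\<in>prime_factors e. 1 / real l))"
            using y0[OF _ de(1) d8 de(3)] elim p(3) by simp
        qed
        ultimately show ?thesis unfolding m using good_mult_prime[OF p(1) _ pm' good] by blast
      qed
    qed
    then show ?case by blast
  qed
qed

subsection \<open>Density\<close>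

lemma card_congruent_le:
  fixes N M :: nat
  assumes "M > 0" "X \<subseteq> {1..N}" "\<And>m n. m \<in> X \<Longrightarrow> n \<in> X \<Longrightarrow> [m = n] (mod M)"
  shows "real (card X) \<le> N / M + 1"
proof -
  have "inj_on (\<lambda>m. m div M) X"
  proof (rule inj_onI)
    fix m n assume "m \<in> X" "n \<in> X" "m div M = n div M"
    with assms(3) show "m = n" by (metis cong_def div_mult_mod_eq)
  qed
  moreover have "(\<lambda>m. m div M) ` X \<subseteq> {..N div M}"
    using assms(2) by (auto intro!: div_le_mono)
  ultimately have "card X \<le> card {..N div M}" by (metis card_image card_mono finite_atMost)
  then have "real (card X) \<le> real (N div M) + 1" by simp
  also have "real (N div M) \<le> N / M" by (rule of_nat_div_le_of_nat)
  finally show ?thesis by simp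
qed

lemma card_multiples_le:
  fixes N b :: nat
  assumes "b > 0"
  shows "real (card {m \<in> {1..N}. b dvd m}) \<le> N / b"
proof -
  have "inj_on (\<lambda>m. m div b) {m \<in> {1..N}. b dvd m}"
    by (rule inj_onI) (metis (mono_tags, lifting) dvd_div_mult_self mem_Collect_eq)
  moreover have "(\<lambda>m. m div b) ` {m \<in> {1..N}. b dvd m} \<subseteq> {1..N div b}"
    using assms by (auto intro!: div_le_mono simp: Suc_le_eq div_greater_zero_iff dvd_imp_le)
  ultimately have "card {m \<in> {1..N}. b dvd m} \<le> card {1..N div b}"
    by (metis (no_types, lifting) card_image card_mono finite_atLeastAtMost)
  then have "real (card {m \<in> {1..N}. b dvd m}) \<le> real (N div b)" by simp
  also have "\<dots> \<le> N / b" by (rule of_nat_div_le_of_nat)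
  finally show ?thesis .
qed

lemma card_residue_class_ge:
  fixes N Q :: nat
  assumes "Q > 0"
  shows "N / Q - 1 \<le> card {m \<in> {1..N}. [m = 1] (mod Q)}"
proof -
  have "(\<lambda>t. 1 + Q * t) ` {..<N div Q} \<subseteq> {m \<in> {1..N}. [m = 1] (mod Q)}"
  proof safe
    fix t assume "t < N div Q"
    then have "Q * (t + 1) \<le> Q * (N div Q)" by (intro mult_le_mono2) simp
    also have "\<dots> \<le> N" by simp
    finally show "1 + Q * t \<in> {1..N}" using assms by (simp add: algebra_simps)
    show "[1 + Q * t = 1] (mod Q)" by (simp only: cong_def mod_mult_self2)
  qed
  then have "card ((\<lambda>t. 1 + Q * t) ` {..<N div Q}) \<le> card {m \<in> {1..N}. [m = 1] (mod Q)}"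
    by (intro card_mono) auto
  then have "real (N div Q) \<le> card {m \<in> {1..N}. [m = 1] (mod Q)}"
    using assms by (subst (asm) card_image) (auto simp: inj_on_def)
  moreover have "N / Q - 1 \<le> real (N div Q)"
  proof -
    have "N \<le> Q * (N div Q) + Q"
      using mod_less_divisor[OF assms, of N] mult_div_mod_eq[of Q N] by linarith
    then have "real N \<le> real (Q * (N div Q) + Q)" by (rule of_nat_mono)
    then show ?thesis using assms by (simp add: field_simps)
  qed
  ultimately show ?thesis by simp
qed

text \<open>Since \<open>b\<close> is coprime to \<open>Q\<close>, its multiples in the class of 1
  modulo \<open>Q\<close> form one class modulo \<open>b * Q\<close>. This count, with error 1, is
  used for the finitely many small \<open>b\<close> and costs half of \<open>N / Q\<close> up to a
  constant; for large \<open>b\<close> the error-free count \<open>N / b\<close> costs at most a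
  quarter. A quarter survives.\<close>

lemma lower_density_avoiding_pos:
  fixes S :: "nat set" and Q :: nat
  assumes Q: "Q > 0" and cop: "\<And>b. b \<in> S \<Longrightarrow> coprime b Q"
    and small: "\<And>F. finite F \<Longrightarrow> F \<subseteq> S \<Longrightarrow> (\<Sum>b\<in>F. 1 / real b) \<le> 1 / 2"
  shows "lower_density {m. [m = 1] (mod Q) \<and> (\<forall>b\<in>S. \<not> b dvd m)} > 0"
proof -
  let ?G = "{m. [m = 1] (mod Q) \<and> (\<forall>b\<in>S. \<not> b dvd m)}"
  define f where "f b = (if b \<in> S then 1 / real b else 0)" for b
  have "summable f"
  proof (rule summableI_nonneg_bounded)
    fix N
    have "(\<Sum>b<N. f b) = (\<Sum>b\<in>{b. b < N \<and> b \<in> S}. 1 / real b)"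
      by (simp add: f_def sum.If_cases Int_def)
    also have "\<dots> \<le> 1 / 2" by (intro small) auto
    finally show "(\<Sum>b<N. f b) \<le> 1 / 2" .
  qed (simp add: f_def)
  \<comment> \<open>The \<open>Q\<close> in the tail bound compensates for the factor
    \<open>Q\<close> lost in the crude count \<open>N / b\<close>.\<close>
  then obtain B where B: "\<And>m n. m \<ge> B \<Longrightarrow> norm (sum f {m..n}) < 1 / (4 * Q)"
    using Q by (elim summable_partial_sum_bound[of f "1 / (4 * Q)"]) auto
  have count: "N / (4 * Q) - (B + 2) \<le> card {n \<in> ?G. 1 \<le> n \<and> n \<le> N}" for N :: nat
  proof -
    define A where "A = {m \<in> {1..N}. [m = 1] (mod Q)}"
    define M where "M b = {m \<in> A. b dvd m}" for b
    define S1 S2 where "S1 = {b \<in> S. b \<in> {1..B}}" and "S2 = {b \<in> S. b \<in> {Suc B..N}}"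
    have fin: "finite A" "finite S1" "finite S2" by (auto simp: A_def S1_def S2_def)
    have "A \<subseteq> {n \<in> ?G. 1 \<le> n \<and> n \<le> N} \<union> (\<Union>b\<in>S1 \<union> S2. M b)"
    proof
      fix m assume m: "m \<in> A"
      show "m \<in> {n \<in> ?G. 1 \<le> n \<and> n \<le> N} \<union> (\<Union>b\<in>S1 \<union> S2. M b)"
      proof (cases "\<exists>b\<in>S. b dvd m")
        case True
        then obtain b where b: "b \<in> S" "b dvd m" by blast
        then have "b > 0" "b \<le> m" using m by (auto simp: A_def intro!: Nat.gr0I dvd_imp_le)
        then have "b \<in> S1 \<union> S2" using b m by (auto simp: S1_def S2_def A_def)
        then show ?thesis using b m by (auto simp: M_def)
      qed (use m in \<open>auto simp: A_def\<close>)
    qed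
    then have "card A \<le> card ({n \<in> ?G. 1 \<le> n \<and> n \<le> N} \<union> (\<Union>b\<in>S1 \<union> S2. M b))"
      using fin by (intro card_mono) (auto simp: M_def)
    also have "\<dots> \<le> card {n \<in> ?G. 1 \<le> n \<and> n \<le> N} + card (\<Union>b\<in>S1 \<union> S2. M b)" by (rule card_Un_le)
    also have "card (\<Union>b\<in>S1 \<union> S2. M b) \<le> (\<Sum>b\<in>S1 \<union> S2. card (M b))" using fin by (intro card_UN_le) auto
    also have "\<dots> = (\<Sum>b\<in>S1. card (M b)) + (\<Sum>b\<in>S2. card (M b))"
      using fin by (intro sum.union_disjoint) (auto simp: S1_def S2_def)
    finally have "real (card A) \<le> card {n \<in> ?G. 1 \<le> n \<and> n \<le> N} + (\<Sum>b\<in>S1. real (card (M b))) + (\<Sum>b\<in>S2. real (card (M b)))"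
      by (simp flip: of_nat_sum of_nat_add)
    moreover have "(\<Sum>b\<in>S1. real (card (M b))) \<le> N / Q * (1 / 2) + B"
    proof -
      have "(\<Sum>b\<in>S1. real (card (M b))) \<le> (\<Sum>b\<in>S1. N / Q * (1 / real b) + 1)"
      proof (rule sum_mono)
        fix b assume b: "b \<in> S1"
        have "real (card (M b)) \<le> N / (b * Q) + 1"
        proof (rule card_congruent_le)
          show "b * Q > 0" using b Q by (auto simp: S1_def)
          show "M b \<subseteq> {1..N}" by (auto simp: M_def A_def)
          fix m n assume "m \<in> M b" "n \<in> M b"
          then have "[m = n] (mod b)" "[m = n] (mod Q)"
            by (auto simp: M_def A_def cong_def)
          then show "[m = n] (mod b * Q)" using cop b by (intro coprime_cong_mult_nat) (auto simp: S1_def)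
        qed
        then show "real (card (M b)) \<le> N / Q * (1 / real b) + 1" by (simp add: mult.commute)
      qed
      also have "\<dots> = N / Q * (\<Sum>b\<in>S1. 1 / real b) + card S1" by (simp add: sum.distrib sum_distrib_left)
      also have "\<dots> \<le> N / Q * (1 / 2) + B"
      proof (intro add_mono mult_left_mono small)
        have "card S1 \<le> card {1..B}" by (intro card_mono) (auto simp: S1_def)
        then show "real (card S1) \<le> B" by simp
      qed (auto simp: S1_def)
      finally show ?thesis .
    qed
    moreover have "(\<Sum>b\<in>S2. real (card (M b))) \<le> N * (1 / (4 * Q))"
    proof -
      have "(\<Sum>b\<in>S2. real (card (M b))) \<le> (\<Sum>b\<in>S2. N * f b)"
      proof (rule sum_mono)
        fix b assume b: "b \<in> S2"
        have "real (card (M b)) \<le> card {m \<in> {1..N}. b dvd m}"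
          by (intro of_nat_mono card_mono) (auto simp: M_def A_def)
        also have "\<dots> \<le> N / b" using b by (intro card_multiples_le) (auto simp: S2_def)
        finally show "real (card (M b)) \<le> N * f b" using b by (simp add: f_def S2_def)
      qed
      also have "\<dots> \<le> N * sum f {Suc B..N}"
        unfolding sum_distrib_left by (intro sum_mono2) (auto simp: S2_def f_def)
      also have "\<dots> \<le> N * (1 / (4 * Q))"
        using B[of "Suc B" N] by (intro mult_left_mono) auto
      finally show ?thesis .
    qed
    moreover have "N / Q - 1 \<le> card A" unfolding A_def by (rule card_residue_class_ge[OF Q])
    moreover have "N / Q - 1 - (N / Q * (1 / 2) + B) - N * (1 / (4 * Q)) = N / (4 * Q) - (B + 1)"
      using Q by (simp add: field_simps)
    ultimately show ?thesis by simp
  qed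
  \<comment> \<open>From this \<open>N\<close> on, the constant \<open>B + 2\<close> is at most half
    of \<open>N / (4 * Q)\<close>.\<close>
  have "eventually (\<lambda>N. 1 / (8 * real Q) \<le> card {n \<in> ?G. 1 \<le> n \<and> n \<le> N} / N) sequentially"
    using eventually_ge_at_top[of "8 * Q * (B + 2)"]
  proof eventually_elim
    case (elim N)
    then have N: "N > 0" using Q by (auto intro!: Nat.gr0I)
    have "real (8 * Q * (B + 2)) \<le> real N" using elim by (rule of_nat_mono)
    then have "real (B + 2) \<le> N / (8 * Q)" using Q by (simp add: field_simps)
    then have "N / (8 * Q) \<le> N / (4 * Q) - (B + 2)" using Q by (simp add: field_simps)
    also note count[of N]
    finally show ?case using N Q by (simp add: field_simps)
  qed
  then have "eventually (\<lambda>N. ereal (1 / (8 * real Q)) \<le> ereal (card {n \<in> ?G. 1 \<le> n \<and> n \<le> N} / N)) sequentially"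
    by simp
  then have "ereal (1 / (8 * real Q)) \<le> lower_density ?G"
    unfolding lower_density_def by (rule Liminf_bounded)
  moreover have "0 < ereal (1 / (8 * real Q))" using Q by simp
  ultimately show ?thesis by (rule less_le_trans[rotated])
qed

lemma lower_density_mono:
  assumes "A \<subseteq> B"
  shows "lower_density A \<le> lower_density B"
proof -
  have "real (card {n \<in> A. 1 \<le> n \<and> n \<le> N}) / N \<le> real (card {n \<in> B. 1 \<le> n \<and> n \<le> N}) / N" for N
  proof (intro divide_right_mono of_nat_mono card_mono)
    show "finite {n \<in> B. 1 \<le> n \<and> n \<le> N}" by (rule finite_subset[of _ "{1..N}"]) auto
  qed (use assms in auto)
  then show ?thesis unfolding lower_density_def by (intro Liminf_mono always_eventually) auto
qed

lemma finite_exceptional: "finite (exceptional n)"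
  by (simp add: exceptional_def)

lemma sum_inverse_exceptional_le: "(\<Sum>b\<in>exceptional n. 1 / real b) \<le> exceptional_weight n"
proof -
  let ?L = "{b. b = n \<and> large_smooth_part n}" and ?Q = "{q. q \<in> {2..<n} \<and> linked n q}"
  have Un_le: "(\<Sum>b\<in>X \<union> Y. 1 / real b) \<le> (\<Sum>b\<in>X. 1 / real b) + (\<Sum>b\<in>Y. 1 / real b)"
    if "finite X" "finite Y" for X Y :: "nat set"
    using that sum.union_inter[of X Y "\<lambda>b. 1 / real b"] sum_nonneg[of "X \<inter> Y" "\<lambda>b. 1 / real b"] by simp
  have "exceptional n = {n\<^sup>2} \<union> ?L \<union> (\<lambda>q. n * q) ` ?Q"
    by (auto simp: exceptional_def)
  then have "(\<Sum>b\<in>exceptional n. 1 / real b) \<le>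
      (\<Sum>b\<in>{n\<^sup>2} \<union> ?L. 1 / real b) + (\<Sum>b\<in>(\<lambda>q. n * q) ` ?Q. 1 / real b)"
    using Un_le[of "{n\<^sup>2} \<union> ?L" "(\<lambda>q. n * q) ` ?Q"] by simp
  also have "(\<Sum>b\<in>{n\<^sup>2} \<union> ?L. 1 / real b) \<le> (\<Sum>b\<in>{n\<^sup>2}. 1 / real b) + (\<Sum>b\<in>?L. 1 / real b)"
    by (rule Un_le) auto
  also have "(\<Sum>b\<in>?L. 1 / real b) = (if large_smooth_part n then 1 / real n else 0)" by simp
  also have "(\<Sum>b\<in>(\<lambda>q. n * q) ` ?Q. 1 / real b) \<le> (\<Sum>q\<in>?Q. 1 / (real n * real q))"
    by (rule order_trans[OF sum_image_le]) (auto simp: o_def)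
  finally show ?thesis by (simp add: exceptional_weight_def)
qed

theorem theorem3:
  shows "lower_density {m. good m} > 0"
proof -
  obtain y1 where y1: "\<And>m n. m \<ge> y1 \<Longrightarrow> norm (sum exceptional_weight {m..n}) < 1 / 2"
    using summable_partial_sum_bound[OF summable_exceptional_weight, of "1 / 2"] by auto
  obtain y where y: "y \<ge> y1" and
    good: "\<And>m. m > 0 \<Longrightarrow> (\<forall>p\<in>prime_factors m. y < p) \<Longrightarrow>
      (\<forall>n>y. \<forall>b\<in>exceptional n. \<not> b dvd m) \<Longrightarrow> good m"
    using eventually_happens[OF eventually_conj[OF eventually_ge_at_top[of y1]
        eventually_good_if_no_exceptional_divisor]] by auto
  \<comment> \<open>The congruence to 1 modulo \<open>Q\<close> keeps all primes up to
    \<open>y\<close> from dividing \<open>m\<close>. The factor 2 makes \<open>Q > 1\<close> for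
    every \<open>y\<close>, which excludes \<open>m = 0\<close>.\<close>
  define Q :: nat where "Q = 2 * fact y"
  \<comment> \<open>Only divisors coprime to \<open>Q\<close> can divide an \<open>m\<close>
    congruent to 1 modulo \<open>Q\<close>, so avoiding these avoids all exceptional divisors with
    \<open>n > y\<close>.\<close>
  define S where "S = {b. coprime b Q \<and> (\<exists>n>y. b \<in> exceptional n)}"
  have weight0: "exceptional_weight n \<ge> 0" for n
    using sum_inverse_exceptional_le[of n] sum_nonneg[of "exceptional n" "\<lambda>b. 1 / real b"] by simp
  have "(\<Sum>b\<in>F. 1 / real b) \<le> 1 / 2" if F: "finite F" "F \<subseteq> S" for F
  proof -
    \<comment> \<open>Each \<open>b\<close> is charged to a single index \<open>\<nu> b\<close>, so
      it counts once even if it lies in several sets \<open>exceptional n\<close>.\<close>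
    have "\<forall>b\<in>F. \<exists>n. n > y \<and> b \<in> exceptional n" using F by (auto simp: S_def)
    then obtain \<nu> where \<nu>: "\<And>b. b \<in> F \<Longrightarrow> \<nu> b > y \<and> b \<in> exceptional (\<nu> b)" by metis
    have "(\<Sum>b\<in>F. 1 / real b) = (\<Sum>n\<in>\<nu> ` F. \<Sum>b | b \<in> F \<and> \<nu> b = n. 1 / real b)"
      using F by (simp add: sum.image_gen)
    also have "\<dots> \<le> (\<Sum>n\<in>\<nu> ` F. exceptional_weight n)"
    proof (rule sum_mono)
      fix n
      have "(\<Sum>b | b \<in> F \<and> \<nu> b = n. 1 / real b) \<le> (\<Sum>b\<in>exceptional n. 1 / real b)"
        using \<nu> by (intro sum_mono2 finite_exceptional) auto
      then show "(\<Sum>b | b \<in> F \<and> \<nu> b = n. 1 / real b) \<le> exceptional_weight n"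
        using sum_inverse_exceptional_le by (rule order_trans)
    qed
    also have "\<dots> \<le> sum exceptional_weight {y..Max (\<nu> ` F)}"
      using \<nu> F weight0 by (intro sum_mono2) (auto simp: less_imp_le)
    also have "\<dots> \<le> 1 / 2" using y1[OF y, of "Max (\<nu> ` F)"] by auto
    finally show ?thesis .
  qed
  then have "0 < lower_density {m. [m = 1] (mod Q) \<and> (\<forall>b\<in>S. \<not> b dvd m)}"
    by (intro lower_density_avoiding_pos) (auto simp: Q_def S_def)
  also have "\<dots> \<le> lower_density {m. good m}"
  proof (rule lower_density_mono, safe)
    fix m assume m: "[m = 1] (mod Q)" "\<forall>b\<in>S. \<not> b dvd m"
    then have copm: "coprime m Q" by (metis cong_imp_coprime cong_sym coprime_1_left)
    show "good m"
    proof (rule good)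
      show "m > 0"
      proof (rule Nat.gr0I)
        assume "m = 0"
        then have "Q = 1" using copm by simp
        then show False by (simp add: Q_def)
      qed
      show "\<forall>p\<in>prime_factors m. y < p"
      proof (intro ballI, rule ccontr)
        fix p assume p: "p \<in> prime_factors m" "\<not> y < p"
        then have "prime p" "p dvd m" by (auto simp: in_prime_factors_iff)
        moreover have "p dvd fact y" using p(2) \<open>prime p\<close> by (simp add: prime_dvd_fact_iff)
        ultimately have "is_unit p" using copm coprime_common_divisor[of m Q p] by (simp add: Q_def)
        then show False using \<open>prime p\<close> by simp
      qed
      show "\<forall>n>y. \<forall>b\<in>exceptional n. \<not> b dvd m"
      proof (intro allI impI ballI notI)
        fix n b assume b: "y < n" "b \<in> exceptional n" "b dvd m"
        have "coprime b Q" using copm b(3) by (rule coprime_divisors[OF _ dvd_refl, rotated])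
        then have "b \<in> S" using b by (auto simp: S_def)
        then show False using m b by blast
      qed
    qed
  qed
  finally show ?thesis .
qed

end
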